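(* (1) $F$ and $G$ lie in $M_{12}$. (2) $G=r^{5}(r+1)$, $F=r(r+1)^{5}$, and $(F+G)^{6}=FG$.
   Context: For even $k\ge 0$, $M_{k}$ is the set of $f\in\mathbb{Z}/2[[x]]$ for which there is a modular form of weight $k$ for $\Gamma_{0}(5)$ whose expansion at infinity (in $x=e^{2\pi i z}$) lies in $\mathbb{Z}[[x]]$ and reduces mod $2$ to $f$. In $\mathbb{Z}/2[[x]]$ let $F=\sum_{n\ \mathrm{odd},\,n>0}x^{n^{2}}$, $G=F(x^{5})$, and $r=\sum_{n>0}(x^{n^{2}}+x^{2n^{2}}+x^{5n^{2}}+x^{10n^{2}})$. *)

theory Defs
  imports "HOL-Complex_Analysis.Complex_Analysis" "HOL-Library.Z2"
    "HOL-Computational_Algebra.Formal_Power_Series"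
begin

definition upper_half_plane :: "complex set" where
  "upper_half_plane = {z. Im z > 0}"

text \<open>Modular form of weight k for Gamma_0(N): holomorphic on the upper half plane,
  weight-k invariant under Gamma_0(N), and holomorphic at every cusp (for every
  gamma in SL2(Z), the slashed function (cz+d)^(-k) f(gamma z) is bounded on Im z >= 1).\<close>
definition modular_form_Gamma0 :: "int \<Rightarrow> nat \<Rightarrow> (complex \<Rightarrow> complex) \<Rightarrow> bool" where
  "modular_form_Gamma0 N k f \<longleftrightarrow>
     f holomorphic_on upper_half_plane \<and>
     (\<forall>a b c d :: int. a * d - b * c = 1 \<and> N dvd c \<longrightarrow>
        (\<forall>z\<in>upper_half_plane.
           f ((of_int a * z + of_int b) / (of_int c * z + of_int d))
             = (of_int c * z + of_int d) ^ k * f z)) \<and>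
     (\<forall>a b c d :: int. a * d - b * c = 1 \<longrightarrow>
        (\<exists>B. \<forall>z. Im z \<ge> 1 \<longrightarrow>
           norm (f ((of_int a * z + of_int b) / (of_int c * z + of_int d)))
             \<le> B * norm (of_int c * z + of_int d) ^ k))"

definition M :: "nat \<Rightarrow> bit fps set" where
  "M k = {h. \<exists>f (a :: nat \<Rightarrow> int). modular_form_Gamma0 5 k f \<and>
             (\<forall>z\<in>upper_half_plane.
                (\<lambda>n. of_int (a n) * exp (2 * pi * \<i> * of_nat n * z)) sums f z) \<and>
             (\<forall>n. fps_nth h n = of_int (a n))}"

definition F :: "bit fps" where
  "F = Abs_fps (\<lambda>m. of_bool (\<exists>n::nat. odd n \<and> m = n ^ 2))"

definition G :: "bit fps" where
  "G = Abs_fps (\<lambda>m. if 5 dvd m then fps_nth F (m div 5) else 0)"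

definition r :: "bit fps" where
  "r = Abs_fps (\<lambda>m. of_bool (\<exists>n::nat. n > 0 \<and> m = n ^ 2)
                 + of_bool (\<exists>n::nat. n > 0 \<and> m = 2 * n ^ 2)
                 + of_bool (\<exists>n::nat. n > 0 \<and> m = 5 * n ^ 2)
                 + of_bool (\<exists>n::nat. n > 0 \<and> m = 10 * n ^ 2))"

end

theory Submission
  imports Defs "HOL-Number_Theory.Cong"
begin

text \<open>
  Membership in \<open>M 12\<close>: modulo 2, the discriminant \<open>\<Delta> = (E\<^sub>4\<^sup>3 - E\<^sub>6\<^sup>2) / 1728\<close> reduces to
  \<open>R + R\<^sup>2\<close>, where the \<open>n\<close>-th coefficient of \<open>R\<close> is the number of odd divisors of \<open>n\<close>, and
  \<open>R + R\<^sup>2 = F\<close>; so \<open>\<Delta>(z)\<close> and \<open>\<Delta>(5z)\<close> witness \<open>F\<close> and \<open>G\<close>. The lattice sums give modularity,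
  and the reflection formula of the polygamma functions gives the \<open>q\<close>-expansions.

  The identities: let \<open>V\<close> be the substitution \<open>x \<mapsto> x\<^sup>5\<close>, and split \<open>F = \<theta>\<^sub>1 + \<theta>\<^sub>3 + V G\<close> by the residue
  of the square root modulo 5. Multiplication by \<open>2 + \<i>\<close> on the Gaussian integers expresses
  \<open>\<theta>\<^sub>1 \<theta>\<^sub>3\<close> and \<open>\<theta>\<^sub>1\<^sup>5 + \<theta>\<^sub>3\<^sup>5\<close> as images under \<open>V\<close>. A series without constant term that is fixed by \<open>V\<close>
  vanishes, whence \<open>\<theta>\<^sub>1 \<theta>\<^sub>3 = G\<^sup>2 + (V G)\<^sup>2\<close> and \<open>\<theta>\<^sub>1\<^sup>5 + \<theta>\<^sub>3\<^sup>5 = G\<close>. With these,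
  \<open>(F + G)\<^sup>6 + F G\<close> is itself fixed by \<open>V\<close>, so it vanishes. As \<open>F + G = r + r\<^sup>2\<close>, both \<open>{F, G}\<close>
  and \<open>{r (r + 1)\<^sup>5, r\<^sup>5 (r + 1)}\<close> are the roots of \<open>X\<^sup>2 + (r + r\<^sup>2) X + (r + r\<^sup>2)\<^sup>6\<close>.
\<close>

section \<open>Power series over the field with two elements\<close>

lemma bit_fps_two [simp]: "(2 :: bit fps) = 0"
proof -
  have "(2 :: bit fps) = fps_const 2"
    by (simp add: numeral_fps_const)
  then show ?thesis by simp
qed

lemma bit_fps_add_self [simp]: "x + x = (0 :: bit fps)"
  by (metis bit_fps_two mult_2 mult_zero_left)

lemma bit_fps_add_self' [simp]: "x + (x + y) = (y :: bit fps)"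
  by (simp flip: add.assoc)

lemma bit_fps_minus [simp]: "- x = (x :: bit fps)"
  by (simp add: minus_unique)

lemma bit_fps_add_eq_0: "x + y = 0 \<longleftrightarrow> x = (y :: bit fps)"
  by (metis bit_fps_minus add_eq_0_iff)

text \<open>Points moved by \<open>\<phi>\<close> come in pairs \<open>{s, \<phi> s}\<close> with
  equal values, and these cancel in characteristic 2.\<close>

lemma sum_involution_bit:
  fixes f :: "'a \<Rightarrow> bit"
  assumes "finite S" "\<And>s. s \<in> S \<Longrightarrow> \<phi> s \<in> S" "\<And>s. s \<in> S \<Longrightarrow> \<phi> (\<phi> s) = s"
    "\<And>s. s \<in> S \<Longrightarrow> f (\<phi> s) = f s"
  shows "sum f S = sum f {s \<in> S. \<phi> s = s}"
  using assms
proof (induction "card S" arbitrary: S rule: less_induct)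
  case less
  show ?case
  proof (cases "\<exists>s\<in>S. \<phi> s \<noteq> s")
    case False
    then have "{s \<in> S. \<phi> s = s} = S" by auto
    then show ?thesis by simp
  next
    case True
    then obtain s where s: "s \<in> S" "\<phi> s \<noteq> s" by auto
    let ?T = "S - {s, \<phi> s}"
    have fin: "finite S" by fact
    have sub: "?T \<subset> S" using s by auto
    have "sum f ?T = sum f {t \<in> ?T. \<phi> t = t}"
    proof (rule less.hyps)
      show "card ?T < card S" using sub fin by (rule psubset_card_mono[rotated])
      show "\<phi> t \<in> ?T" if "t \<in> ?T" for t
        using that less.prems(2,3) s by (metis DiffD1 DiffD2 DiffI insertCI insertE singletonD)
    qed (use less.prems in auto)
    moreover have "{t \<in> ?T. \<phi> t = t} = {t \<in> S. \<phi> t = t}"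
      using s less.prems(3) by auto
    moreover have "sum f S = sum f ?T + sum f {s, \<phi> s}"
      using fin s less.prems(2) by (subst sum.subset_diff[of "{s, \<phi> s}"]) auto
    moreover have "sum f {s, \<phi> s} = 0"
      using s less.prems(4) by simp
    ultimately show ?thesis by simp
  qed
qed

section \<open>Substitution of powers of the variable, and the Frobenius\<close>

definition V :: "nat \<Rightarrow> bit fps \<Rightarrow> bit fps" where
  "V k f = f oo fps_X ^ k"

lemma V_nth: "k > 0 \<Longrightarrow> fps_nth (V k f) n = (if k dvd n then fps_nth f (n div k) else 0)"
  unfolding V_def by (rule fps_nth_compose_X_power)

lemma V_add: "V k (f + g) = V k f + V k g"
  unfolding V_def by (rule fps_compose_add_distrib)

lemma V_mult: "k > 0 \<Longrightarrow> V k (f * g) = V k f * V k g"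
  unfolding V_def by (rule fps_compose_mult_distrib) simp

lemma V_power: "k > 0 \<Longrightarrow> V k (f ^ n) = V k f ^ n"
  unfolding V_def by (simp add: fps_compose_power)

lemma V_V: "0 < k \<Longrightarrow> 0 < l \<Longrightarrow> V k (V l f) = V (k * l) f"
  by (rule fps_ext) (auto simp: V_nth div_mult2_eq dvd_div_iff_mult mult.commute
      elim: dvd_mult_left)

text \<open>For \<open>n > 0\<close> the coefficient at \<open>n\<close> is zero or equals the one
  at \<open>n div k < n\<close>, so descent ends at the constant term. This turns functional
  equations under \<open>V\<close> into identities.\<close>

lemma V_fixed_imp_const:
  assumes "k > 1" "V k f = f" "fps_nth f 0 = 0"
  shows "f = 0"
proof (rule fps_ext)
  fix n show "fps_nth f n = fps_nth 0 n"
  proof (induction n rule: less_induct)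
    case (less n)
    show ?case
    proof (cases "n = 0")
      case False
      have "fps_nth f n = fps_nth (V k f) n" by (simp add: assms)
      also have "\<dots> = 0"
        using assms(1) less[of "n div k"] False by (simp add: V_nth)
      finally show ?thesis by simp
    qed (use assms in simp)
  qed
qed

text \<open>In the Cauchy product the terms \<open>i\<close> and \<open>n - i\<close> cancel. Only
  the diagonal \<open>i = n div 2\<close> is left, and every bit equals its square.\<close>

lemma bit_fps_square: "f ^ 2 = V 2 f"
proof (rule fps_ext)
  fix n
  have "fps_nth (f ^ 2) n = (\<Sum>i\<in>{0..n}. fps_nth f i * fps_nth f (n - i))"
    by (simp add: power2_eq_square fps_mult_nth)
  also have "\<dots> = (\<Sum>i\<in>{i \<in> {0..n}. n - i = i}. fps_nth f i * fps_nth f (n - i))"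
    by (rule sum_involution_bit) (auto simp: mult.commute)
  also have "{i \<in> {0..n}. n - i = i} = (if even n then {n div 2} else {})"
    by (auto elim!: evenE) presburger+
  also have "(\<Sum>i\<in>\<dots>. fps_nth f i * fps_nth f (n - i)) = fps_nth (V 2 f) n"
    by (cases "fps_nth f (n div 2)") (auto simp: V_nth simp flip: mult_2 elim!: evenE)
  finally show "fps_nth (f ^ 2) n = fps_nth (V 2 f) n" .
qed

lemma bit_fps_power4: "f ^ 4 = V 4 f"
proof -
  have "f ^ 4 = (f ^ 2) ^ 2" by (simp flip: power_mult)
  then show ?thesis by (simp add: bit_fps_square V_V)
qed

lemma bit_fps_square_add: "(x + y) ^ 2 = x ^ 2 + (y :: bit fps) ^ 2"
  by (simp add: bit_fps_square V_add)

section \<open>Theta series modulo 2\<close>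

text \<open>The series of \<open>x ^ (a ^ 2)\<close> over \<open>a\<close> in \<open>S\<close>.
  Integers of both signs are allowed, so that residue classes can serve as index sets and
  \<open>a\<close> can cancel against \<open>- a\<close>.\<close>

definition theta :: "int set \<Rightarrow> bit fps" where
  "theta S = Abs_fps (\<lambda>n. of_nat (card {a \<in> S. a\<^sup>2 = int n}))"

text \<open>The analogue for the norm form on the Gaussian integers
  \<open>a + b * \<i>\<close>.\<close>

definition theta2 :: "(int \<times> int) set \<Rightarrow> bit fps" where
  "theta2 T = Abs_fps (\<lambda>n. of_nat (card {(a, b). (a, b) \<in> T \<and> a\<^sup>2 + b\<^sup>2 = int n}))"

lemma abs_le_of_square_le: "a\<^sup>2 \<le> int n \<Longrightarrow> \<bar>a\<bar> \<le> int n"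
proof -
  assume a: "a\<^sup>2 \<le> int n"
  have "\<bar>a\<bar> * 1 \<le> \<bar>a\<bar> * \<bar>a\<bar>"
  proof (cases "a = 0")
    case False
    then show ?thesis by (intro mult_left_mono) auto
  qed simp
  with a show ?thesis by (simp add: power2_eq_square)
qed

lemma finite_sq: "finite {a :: int. a \<in> S \<and> a\<^sup>2 = int n}"
proof (rule finite_subset)
  show "{a. a \<in> S \<and> a\<^sup>2 = int n} \<subseteq> {- int n..int n}"
  proof clarify
    fix a assume "a\<^sup>2 = int n"
    then have "\<bar>a\<bar> \<le> int n" by (intro abs_le_of_square_le) simp
    then show "a \<in> {- int n..int n}" by auto
  qed
qed simp

lemma finite_sq2: "finite {(a :: int, b :: int). (a, b) \<in> T \<and> a\<^sup>2 + b\<^sup>2 = int n}"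
proof (rule finite_subset)
  show "{(a, b). (a, b) \<in> T \<and> a\<^sup>2 + b\<^sup>2 = int n} \<subseteq> {- int n..int n} \<times> {- int n..int n}"
  proof clarify
    fix a b :: int assume ab: "a\<^sup>2 + b\<^sup>2 = int n"
    have "a\<^sup>2 \<le> int n" "b\<^sup>2 \<le> int n"
      using ab zero_le_power2[of a] zero_le_power2[of b] by linarith+
    then have "\<bar>a\<bar> \<le> int n" "\<bar>b\<bar> \<le> int n" by (auto dest: abs_le_of_square_le)
    then show "a \<in> {- int n..int n} \<and> b \<in> {- int n..int n}" by auto
  qed
qed auto

lemma theta_Un:
  assumes "S \<inter> S' = {}"
  shows "theta (S \<union> S') = theta S + theta S'"
proof (rule fps_ext)
  fix n
  have "{a \<in> S \<union> S'. a\<^sup>2 = int n} = {a \<in> S. a\<^sup>2 = int n} \<union> {a \<in> S'. a\<^sup>2 = int n}" by auto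
  moreover have "card \<dots> = card {a \<in> S. a\<^sup>2 = int n} + card {a \<in> S'. a\<^sup>2 = int n}"
    using assms by (intro card_Un_disjoint finite_sq) auto
  ultimately show "fps_nth (theta (S \<union> S')) n = fps_nth (theta S + theta S') n"
    by (simp add: theta_def)
qed

lemma theta_image:
  assumes "inj_on h S" "\<And>a. a \<in> S \<Longrightarrow> (h a)\<^sup>2 = a\<^sup>2"
  shows "theta (h ` S) = theta S"
proof (rule fps_ext)
  fix n
  have "{a \<in> h ` S. a\<^sup>2 = int n} = h ` {a \<in> S. a\<^sup>2 = int n}" using assms by auto
  moreover have "card \<dots> = card {a \<in> S. a\<^sup>2 = int n}"
    by (rule card_image) (use assms in \<open>auto simp: inj_on_def\<close>)
  ultimately show "fps_nth (theta (h ` S)) n = fps_nth (theta S) n"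
    by (simp add: theta_def)
qed

lemma theta_scale:
  assumes "k > 0"
  shows "theta ((*) (int k) ` S) = V (k\<^sup>2) (theta S)"
proof (rule fps_ext)
  fix n
  show "fps_nth (theta ((*) (int k) ` S)) n = fps_nth (V (k\<^sup>2) (theta S)) n"
  proof (cases "k\<^sup>2 dvd n")
    case True
    then obtain m where m: "n = k\<^sup>2 * m" ..
    have "{a \<in> (*) (int k) ` S. a\<^sup>2 = int n} = (*) (int k) ` {a \<in> S. a\<^sup>2 = int m}"
      using assms by (auto simp: m power_mult_distrib)
    moreover have "card \<dots> = card {a \<in> S. a\<^sup>2 = int m}"
      by (rule card_image) (use assms in \<open>auto simp: inj_on_def\<close>)
    ultimately show ?thesis using assms by (simp add: theta_def V_nth m)
  next
    case False
    have "a\<^sup>2 \<noteq> int n" if a: "a \<in> (*) (int k) ` S" for a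
    proof
      assume "a\<^sup>2 = int n"
      moreover obtain x where "a = int k * x" using a by blast
      ultimately have "int n = int (k\<^sup>2) * x\<^sup>2" by (simp add: power_mult_distrib)
      then have "int (k\<^sup>2) dvd int n" by (rule dvdI)
      with False show False by (simp add: int_dvd_int_iff del: of_nat_power)
    qed
    then have "{a \<in> (*) (int k) ` S. a\<^sup>2 = int n} = {}" by blast
    then have "fps_nth (theta ((*) (int k) ` S)) n = 0"
      by (simp only: theta_def fps_nth_Abs_fps card.empty of_nat_0)
    then show ?thesis using False assms by (simp add: V_nth)
  qed
qed

text \<open>Negation pairs the square roots of \<open>n\<close> in \<open>S\<close>; without
  \<open>0\<close> it has no fixed point.\<close>

lemma theta_symmetric:
  assumes "uminus ` S = S" "0 \<notin> S"
  shows "theta S = 0"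
proof (rule fps_ext)
  fix n
  have "of_nat (card {a \<in> S. a\<^sup>2 = int n}) = (\<Sum>a\<in>{a \<in> S. a\<^sup>2 = int n}. 1 :: bit)"
    by simp
  also have "\<dots> = (\<Sum>a\<in>{a \<in> {a \<in> S. a\<^sup>2 = int n}. - a = a}. 1 :: bit)"
    by (rule sum_involution_bit) (use assms finite_sq in auto)
  also have "{a \<in> {a \<in> S. a\<^sup>2 = int n}. - a = a} = {}"
    using assms by auto
  finally show "fps_nth (theta S) n = fps_nth 0 n"
    by (simp add: theta_def)
qed

lemma theta_mult: "theta S * theta S' = theta2 (S \<times> S')"
proof (rule fps_ext)
  fix n
  let ?A = "\<lambda>i. {a \<in> S. a\<^sup>2 = int i}" and ?B = "\<lambda>i. {a \<in> S'. a\<^sup>2 = int i}"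
  have "{(a, b). (a, b) \<in> S \<times> S' \<and> a\<^sup>2 + b\<^sup>2 = int n} = (\<Union>i\<in>{0..n}. ?A i \<times> ?B (n - i))"
  proof (intro equalityI subsetI, clarify)
    fix a b assume ab: "a \<in> S" "b \<in> S'" "a\<^sup>2 + b\<^sup>2 = int n"
    have "a\<^sup>2 \<le> int n" using ab zero_le_power2[of b] by linarith
    then have "nat (a\<^sup>2) \<le> n" "a\<^sup>2 = int (nat (a\<^sup>2))" by (simp_all add: nat_le_iff)
    moreover have "b\<^sup>2 = int (n - nat (a\<^sup>2))"
      using ab calculation by (simp add: of_nat_diff)
    ultimately show "(a, b) \<in> (\<Union>i\<in>{0..n}. ?A i \<times> ?B (n - i))"
      using ab by (intro UN_I[of "nat (a\<^sup>2)"]) auto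
  qed (auto simp: of_nat_diff)
  moreover have "card (\<Union>i\<in>{0..n}. ?A i \<times> ?B (n - i)) = (\<Sum>i\<in>{0..n}. card (?A i \<times> ?B (n - i)))"
  proof (rule card_UN_disjoint)
    show "\<forall>i\<in>{0..n}. finite (?A i \<times> ?B (n - i))"
      by (intro ballI finite_SigmaI finite_sq)
  qed auto
  ultimately show "fps_nth (theta S * theta S') n = fps_nth (theta2 (S \<times> S')) n"
    by (simp add: theta_def theta2_def fps_mult_nth card_cartesian_product)
qed

lemma theta2_UN:
  assumes "finite I" "\<And>i j. i \<in> I \<Longrightarrow> j \<in> I \<Longrightarrow> i \<noteq> j \<Longrightarrow> T i \<inter> T j = {}"
  shows "theta2 (\<Union>i\<in>I. T i) = (\<Sum>i\<in>I. theta2 (T i))"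
proof (rule fps_ext)
  fix n
  have "{(a, b). (a, b) \<in> (\<Union>i\<in>I. T i) \<and> a\<^sup>2 + b\<^sup>2 = int n}
      = (\<Union>i\<in>I. {(a, b). (a, b) \<in> T i \<and> a\<^sup>2 + b\<^sup>2 = int n})" by auto
  moreover have "card \<dots> = (\<Sum>i\<in>I. card {(a, b). (a, b) \<in> T i \<and> a\<^sup>2 + b\<^sup>2 = int n})"
    by (rule card_UN_disjoint) (use assms finite_sq2 in \<open>fast+\<close>)
  ultimately show "fps_nth (theta2 (\<Union>i\<in>I. T i)) n = fps_nth (\<Sum>i\<in>I. theta2 (T i)) n"
    by (simp add: theta2_def fps_sum_nth)
qed

text \<open>Multiplication by \<open>2 + \<i>\<close>, up to conjugation.\<close>

lemma theta2_rotate: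
  assumes "\<And>c d. (c, d) \<in> T \<longleftrightarrow> (2 * c + d, c - 2 * d) \<in> T'"
    and "\<And>a b. (a, b) \<in> T' \<Longrightarrow> 5 dvd 2 * a + b"
  shows "theta2 T' = V 5 (theta2 T)"
proof (rule fps_ext)
  fix n
  let ?h = "\<lambda>(c, d). (2 * c + d, c - 2 * d) :: int \<times> int"
  have T': "(a, b) \<in> T' \<longleftrightarrow> (\<exists>c d. (c, d) \<in> T \<and> a = 2 * c + d \<and> b = c - 2 * d)" for a b
  proof
    assume ab: "(a, b) \<in> T'"
    \<comment> \<open>The inverse rotation is \<open>c = (2 * a + b) / 5\<close>,
      \<open>d = (a - 2 * b) / 5\<close>. The divisibility assumption makes \<open>c\<close> an
      integer, hence also \<open>d = a - 2 * c\<close>.\<close>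
    from assms(2)[OF this] obtain c where c: "2 * a + b = 5 * c" by auto
    define d where "d = a - 2 * c"
    have "a = 2 * c + d" "b = c - 2 * d" using c by (auto simp: d_def)
    with ab assms(1) show "\<exists>c d. (c, d) \<in> T \<and> a = 2 * c + d \<and> b = c - 2 * d" by blast
  qed (use assms(1) in blast)
  \<comment> \<open>Multiplicativity of the norm; 5 is the norm of \<open>2 + \<i>\<close>.\<close>
  have norm: "(2 * c + d)\<^sup>2 + (c - 2 * d)\<^sup>2 = 5 * (c\<^sup>2 + d\<^sup>2)" for c d :: int
    by (simp add: power2_eq_square algebra_simps)
  show "fps_nth (theta2 T') n = fps_nth (V 5 (theta2 T)) n"
  proof (cases "5 dvd n")
    case True
    then obtain m where m: "n = 5 * m" ..
    have "{(a, b). (a, b) \<in> T' \<and> a\<^sup>2 + b\<^sup>2 = int n}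
        = ?h ` {(c, d). (c, d) \<in> T \<and> c\<^sup>2 + d\<^sup>2 = int m}"
      using norm by (force simp: T' m)
    moreover have "card \<dots> = card {(c, d). (c, d) \<in> T \<and> c\<^sup>2 + d\<^sup>2 = int m}"
      by (rule card_image) (auto simp: inj_on_def)
    ultimately show ?thesis by (simp add: theta2_def V_nth m)
  next
    case False
    have "{(a, b). (a, b) \<in> T' \<and> a\<^sup>2 + b\<^sup>2 = int n} = {}"
    proof -
      have "int n \<noteq> 5 * x" for x using False by presburger
      then have "5 * (c\<^sup>2 + d\<^sup>2) \<noteq> int n" for c d by metis
      then show ?thesis by (auto simp: T' norm simp del: distrib_left_numeral)
    qed
    then have "fps_nth (theta2 T') n = 0"
      by (simp only: theta2_def fps_nth_Abs_fps card.empty of_nat_0)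
    then show ?thesis using False by (simp add: V_nth)
  qed
qed

section \<open>Theta series of residue classes and their dissection by 5\<close>

definition residue_theta :: "int \<Rightarrow> int \<Rightarrow> bit fps" where
  "residue_theta m i = theta {a. [a = i] (mod m)}"

text \<open>All pairs on the left are rotated points, because
  \<open>2 * (2 * c + d) + (c - 2 * d) = 5 * c\<close> and 5 divides both moduli. Their preimages
  are the points \<open>(c + 2 * t, d - 4 * t)\<close> up to the moduli 10 and \<open>n\<close>.
  Raising \<open>t\<close> by 5 moves the coordinates by 10 and -20, so \<open>t\<close> matters
  only modulo 5 and five disjoint boxes remain.\<close>

lemma residue_theta_dissection:
  assumes n: "10 dvd n" "n dvd 20"
  shows "residue_theta n (2 * c + d) * residue_theta 10 (c - 2 * d)
       = V 5 (\<Sum>s<5. residue_theta 10 (c + 2 * int s) * residue_theta n (d - 4 * int s))"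
proof -
  let ?box = "\<lambda>s. {a. [a = c + 2 * int s] (mod 10)} \<times> {a. [a = d - 4 * int s] (mod n)}"
  let ?T' = "{a. [a = 2 * c + d] (mod n)} \<times> {a. [a = c - 2 * d] (mod 10)}"
  obtain k where k: "n = 10 * k" using n by blast
  obtain l where l: "20 = n * l" using n by blast
  have mem: "(x, y) \<in> (\<Union>s<5. ?box s) \<longleftrightarrow> (2 * x + y, x - 2 * y) \<in> ?T'" for x y
  proof
    assume "(x, y) \<in> (\<Union>s<5. ?box s)"
    then obtain s where "10 dvd x - (c + 2 * int s)" "n dvd y - (d - 4 * int s)"
      by (auto simp: cong_iff_dvd_diff)
    then obtain i j where "x - (c + 2 * int s) = 10 * i" "y - (d - 4 * int s) = n * j"
      by (elim dvdE)
    then have x: "x = c + 2 * int s + 10 * i" and y: "y = d - 4 * int s + n * j"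
      by (simp_all add: algebra_simps)
    have "2 * x + y = 2 * c + d + (20 * i + n * j)"
      using x y by simp
    also have "20 * i + n * j = n * (l * i + j)"
      using l by (simp add: distrib_left flip: mult.assoc)
    finally have "2 * x + y = 2 * c + d + n * (l * i + j)" .
    then have "[2 * x + y = 2 * c + d] (mod n)"
      by (simp add: cong_def)
    moreover have "x - 2 * y - (c - 2 * d) = 10 * (i + s - 2 * k * j)"
      using x y k by (simp add: algebra_simps)
    then have "[x - 2 * y = c - 2 * d] (mod 10)"
      unfolding cong_iff_dvd_diff by (rule dvdI)
    ultimately show "(2 * x + y, x - 2 * y) \<in> ?T'"
      by simp
  next
    assume "(2 * x + y, x - 2 * y) \<in> ?T'"
    then have "n dvd 2 * x + y - (2 * c + d)" "10 dvd x - 2 * y - (c - 2 * d)"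
      by (simp_all add: cong_iff_dvd_diff)
    then obtain i j where i: "2 * x + y - (2 * c + d) = n * i" and j: "x - 2 * y - (c - 2 * d) = 10 * j"
      by (elim dvdE)
    \<comment> \<open>The parameter \<open>t\<close> fits both congruences: the second gives
      \<open>x - c = 2 * t\<close>, and then the first gives
      \<open>y = d - 4 * t + n * i\<close>.\<close>
    define t where "t = y - d + 5 * j"
    have x: "x = c + 2 * t" using j by (simp add: t_def)
    have y: "y = d - 4 * t + n * i" using i x by simp
    define s where "s = nat (t mod 5)"
    have s: "s < 5" "t = int s + 5 * (t div 5)" by (auto simp: s_def)
    have "x = c + 2 * int s + 10 * (t div 5)" "y = d - 4 * int s + n * (i - l * (t div 5))"
      using x y arg_cong[OF s(2), of "\<lambda>u. 2 * u"] arg_cong[OF s(2), of "\<lambda>u. 4 * u"]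
        arg_cong[OF l, of "\<lambda>u. u * (t div 5)"]
      by (simp_all add: right_diff_distrib flip: mult.assoc)
    then have "(x, y) \<in> ?box s" by (simp add: cong_def)
    with s show "(x, y) \<in> (\<Union>s<5. ?box s)" by blast
  qed
  have disj: "?box s \<inter> ?box t = {}" if "s \<in> {..<5}" "t \<in> {..<5}" "s \<noteq> t" for s t
  proof -
    have "\<not> [c + 2 * int s = c + 2 * int t] (mod 10)"
      using that by (auto simp: cong_iff_dvd_diff) presburger
    then show ?thesis by (auto dest: cong_sym cong_trans)
  qed
  have "theta2 ?T' = V 5 (theta2 (\<Union>s<5. ?box s))"
  proof (rule theta2_rotate)
    fix a b assume "(a, b) \<in> ?T'"
    then have "n dvd a - (2 * c + d)" "10 dvd b - (c - 2 * d)"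
      by (simp_all add: cong_iff_dvd_diff)
    then obtain i j where "a - (2 * c + d) = n * i" "b - (c - 2 * d) = 10 * j"
      by (elim dvdE)
    then have "2 * a + b = 5 * (c + 4 * k * i + 2 * j)"
      using k by (simp add: algebra_simps)
    then show "5 dvd 2 * a + b" by simp
  qed (rule mem)
  also have "theta2 (\<Union>s<5. ?box s) = (\<Sum>s<5. theta2 (?box s))"
    using disj by (intro theta2_UN) auto
  finally show ?thesis by (simp only: residue_theta_def theta_mult)
qed

lemma theta_abs: "inj_on abs S \<Longrightarrow> theta (abs ` S) = theta S"
  by (rule theta_image) auto

lemma residue_theta_cong: "[i = j] (mod m) \<Longrightarrow> residue_theta m i = residue_theta m j"
  unfolding residue_theta_def by (intro arg_cong[of _ _ theta] Collect_cong) (auto intro: cong_trans cong_sym)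

lemma residue_theta_minus: "residue_theta m (- i) = residue_theta m i"
proof -
  have "{a. [a = - i] (mod m)} = uminus ` {a. [a = i] (mod m)}"
    using cong_minus_minus_iff by (force intro!: image_eqI[of _ uminus "- x" for x])
  then show ?thesis
    unfolding residue_theta_def by (simp add: theta_image)
qed

text \<open>Such a class is its own negative and omits 0, so its squares cancel in pairs.\<close>

lemma residue_theta_half:
  assumes "\<not> m dvd i" "m dvd 2 * i"
  shows "residue_theta m i = 0"
  unfolding residue_theta_def
proof (rule theta_symmetric)
  have *: "[- a = i] (mod m)" if "[a = i] (mod m)" for a
  proof -
    have "m dvd - (a - i) - 2 * i"
      using that assms(2) by (intro dvd_diff) (simp_all add: cong_iff_dvd_diff dvd_diff_commute)
    also have "- (a - i) - 2 * i = - a - i" by simp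
    finally show ?thesis by (simp add: cong_iff_dvd_diff)
  qed
  then show "uminus ` {a. [a = i] (mod m)} = {a. [a = i] (mod m)}"
    by (force intro!: image_eqI[of _ uminus "- x" for x])
  show "0 \<notin> {a. [a = i] (mod m)}"
    using assms(1) by (simp add: cong_iff_dvd_diff)
qed

lemma residue_theta_0:
  assumes "m > 0"
  shows "residue_theta m 0 = 1"
proof -
  have "{a. [a = 0] (mod m)} = {0} \<union> {a. [a = 0] (mod m) \<and> a \<noteq> 0}"
    by auto
  then have "residue_theta m 0 = theta {0} + theta {a. [a = 0] (mod m) \<and> a \<noteq> 0}"
    unfolding residue_theta_def by (subst theta_Un[symmetric]) simp_all
  also have "theta {a. [a = 0] (mod m) \<and> a \<noteq> 0} = 0"
    by (rule theta_symmetric) (force simp: cong_0_iff intro!: image_eqI[of _ uminus "- x" for x])+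
  also have "theta {0} = 1"
  proof (rule fps_ext)
    fix n
    have "{a \<in> {0}. a\<^sup>2 = int n} = (if n = 0 then {0} else {})" by auto
    then show "fps_nth (theta {0}) n = fps_nth 1 n" by (simp only: theta_def fps_nth_Abs_fps) simp
  qed
  finally show ?thesis by simp
qed

text \<open>Applying the Frobenius twice replaces \<open>x\<close> by \<open>x ^ 4\<close>, which
  doubles every \<open>a\<close> in the exponent \<open>a ^ 2\<close>. Fourth powers thus become
  theta series modulo 20.\<close>

lemma residue_theta_power4:
  "residue_theta 10 i ^ 4 = residue_theta 20 (2 * i)"
proof -
  have "{a. [a = 2 * i] (mod 20)} = (*) (int 2) ` {a. [a = i] (mod 10)}"
  proof -
    have "\<exists>b. a = 2 * b \<and> [b = i] (mod 10)" if "[a = 2 * i] (mod 20)" for a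
      using that by (intro exI[of _ "a div 2"]) (simp add: cong_iff_dvd_diff, presburger)
    moreover have "[2 * b = 2 * i] (mod 20)" if "[b = i] (mod 10)" for b
      using that by (simp add: cong_iff_dvd_diff, presburger)
    ultimately show ?thesis by auto
  qed
  then show ?thesis
    using theta_scale[of 2 "{a. [a = i] (mod 10)}"]
    by (simp add: residue_theta_def bit_fps_power4)
qed

text \<open>As \<open>a\<close> and \<open>- a\<close> have the same square, these two series account for all odd residue classes
  modulo 10 except 5, whose series vanishes modulo 2.\<close>

definition theta1 :: "bit fps" where "theta1 = residue_theta 10 1"
definition theta3 :: "bit fps" where "theta3 = residue_theta 10 3"

lemma residue_theta_eq_theta1: "[i = 1] (mod 10) \<or> [i = -1] (mod 10) \<Longrightarrow> residue_theta 10 i = theta1"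
  unfolding theta1_def by (metis residue_theta_cong residue_theta_minus)

lemma residue_theta_eq_theta3: "[i = 3] (mod 10) \<or> [i = -3] (mod 10) \<Longrightarrow> residue_theta 10 i = theta3"
  unfolding theta3_def by (metis residue_theta_cong residue_theta_minus)

lemma residue_theta_20_eq_theta1: "[i = 2] (mod 20) \<or> [i = -2] (mod 20) \<Longrightarrow> residue_theta 20 i = theta1 ^ 4"
  using residue_theta_power4[of 1] unfolding theta1_def
  by simp (metis residue_theta_cong residue_theta_minus)

lemma residue_theta_20_eq_theta3: "[i = 6] (mod 20) \<or> [i = -6] (mod 20) \<Longrightarrow> residue_theta 20 i = theta3 ^ 4"
  using residue_theta_power4[of 3] unfolding theta3_def
  by simp (metis residue_theta_cong residue_theta_minus)

lemmas residue_theta_simps =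
  residue_theta_eq_theta1 residue_theta_eq_theta3 residue_theta_20_eq_theta1 residue_theta_20_eq_theta3
  residue_theta_half

lemma sum_lessThan_5: "(\<Sum>s<5. f s) = f 0 + f 1 + f 2 + f 3 + f (4 :: nat)"
  by (simp add: eval_nat_numeral)

lemma theta1_mult_theta3_dissection: "theta1 * theta3 = V 5 (theta1 ^ 2 + theta3 ^ 2 + theta1 * theta3)"
proof -
  \<comment> \<open>The choice \<open>c = 5\<close>, \<open>d = 1\<close> yields the classes 11 and
    3 modulo 10. Of the five boxes, the first and the last involve the class of 5 and
    vanish.\<close>
  have "theta1 * theta3 = residue_theta 10 (2 * 5 + 1) * residue_theta 10 (5 - 2 * 1)"
    by (simp add: residue_theta_simps cong_def)
  also have "\<dots> = V 5 (theta1 ^ 2 + theta3 ^ 2 + theta1 * theta3)"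
    by (subst residue_theta_dissection)
       (simp_all add: sum_lessThan_5 residue_theta_simps cong_def power2_eq_square algebra_simps)
  finally show ?thesis .
qed

lemma residue_theta_20_4:
  "NO_MATCH 4 i \<Longrightarrow> [i = 4] (mod 20) \<or> [i = -4] (mod 20)
    \<Longrightarrow> residue_theta 20 i = residue_theta 20 4"
  by (metis residue_theta_cong residue_theta_minus)

lemma residue_theta_20_8:
  "NO_MATCH 8 i \<Longrightarrow> [i = 8] (mod 20) \<or> [i = -8] (mod 20)
    \<Longrightarrow> residue_theta 20 i = residue_theta 20 8"
  by (metis residue_theta_cong residue_theta_minus)

text \<open>Each fifth power is a fourth power, hence a series modulo 20, times a series modulo 10,
  so the dissection with \<open>n = 20\<close> applies. In the sum of both, the terms
  \<open>theta3 * ?C8\<close> and \<open>theta1 * ?C4\<close> cancel; dissecting the surviving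
  products \<open>?C4 * theta3\<close> and \<open>?C8 * theta1\<close> once more leads back to fifth
  powers.\<close>

lemma theta_power5_dissection: "theta1 ^ 5 + theta3 ^ 5 = V 5 (theta1 + theta3 + V 5 (theta1 ^ 5 + theta3 ^ 5))"
proof -
  let ?C4 = "residue_theta 20 4" and ?C8 = "residue_theta 20 8"
  note simps = sum_lessThan_5 residue_theta_simps residue_theta_20_4 residue_theta_20_8
    residue_theta_0 cong_def
  have 1: "theta1 ^ 4 * theta1 = V 5 (theta1 + theta3 * ?C4 + theta3 * ?C8 + theta1 * ?C4)"
    using residue_theta_dissection[of 20 1 0] by (simp add: simps)
  have 2: "theta3 ^ 4 * theta3 = V 5 (theta3 + theta3 * ?C8 + theta1 * ?C8 + theta1 * ?C4)"
    using residue_theta_dissection[of 20 3 0] by (simp add: simps)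
  \<comment> \<open>Here \<open>2 * c + d = 16\<close>, which is -4 modulo 20, and
    \<open>c - 2 * d = -27\<close>, which is 3 modulo 10; the next choice gives 12 and -19 in the
    same way.\<close>
  have 3: "?C4 * theta3 = V 5 (theta3 * theta1 ^ 4 + theta1 * theta3 ^ 4 + theta1 * theta1 ^ 4)"
    using residue_theta_dissection[of 20 1 14] by (simp add: simps algebra_simps)
  have 4: "?C8 * theta1 = V 5 (theta3 * theta3 ^ 4 + theta1 * theta3 ^ 4 + theta3 * theta1 ^ 4)"
    using residue_theta_dissection[of 20 1 10] by (simp add: simps algebra_simps)
  have pow5: "x ^ 5 = x * x ^ 4" for x :: "bit fps"
    by (simp add: eval_nat_numeral)
  have 5: "?C4 * theta3 + ?C8 * theta1 = V 5 (theta1 ^ 5 + theta3 ^ 5)"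
    unfolding 3 4 V_add[symmetric] pow5 by (simp add: ac_simps)
  have "theta1 ^ 5 + theta3 ^ 5 = theta1 ^ 4 * theta1 + theta3 ^ 4 * theta3"
    unfolding pow5 by (simp add: ac_simps)
  also have "\<dots> = V 5 (theta1 + theta3 + (?C4 * theta3 + ?C8 * theta1))"
    unfolding 1 2 V_add[symmetric] by (simp add: ac_simps)
  finally show ?thesis unfolding 5 .
qed

section \<open>The relation of level 5\<close>

lemma G_eq: "G = V 5 F"
  by (rule fps_ext) (simp add: G_def V_nth)

lemma card_square_roots: "card {n. P n \<and> m = n\<^sup>2} = of_bool (\<exists>n :: nat. P n \<and> m = n\<^sup>2)"
proof (cases "\<exists>n. P n \<and> m = n\<^sup>2")
  case True
  then obtain n where "P n" "m = n\<^sup>2" by blast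
  moreover from this have "{n. P n \<and> m = n\<^sup>2} = {n}" by auto
  ultimately show ?thesis by auto
next
  case False
  then have "{n. P n \<and> m = n\<^sup>2} = {}" by blast
  with False show ?thesis by (simp only: card.empty of_bool_eq)
qed

lemma nth_theta_positive:
  "fps_nth (theta {a. a > 0 \<and> P (nat a)}) m = of_bool (\<exists>n. (n > 0 \<and> P n) \<and> m = n\<^sup>2)"
proof -
  have "{a \<in> {a. a > 0 \<and> P (nat a)}. a\<^sup>2 = int m} = int ` {n. (n > 0 \<and> P n) \<and> m = n\<^sup>2}"
  proof (intro equalityI subsetI)
    fix a assume "a \<in> {a \<in> {a. a > 0 \<and> P (nat a)}. a\<^sup>2 = int m}"
    moreover from this have "m = (nat a)\<^sup>2" by (simp flip: nat_power_eq)
    ultimately show "a \<in> int ` {n. (n > 0 \<and> P n) \<and> m = n\<^sup>2}"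
      by (intro image_eqI[of _ _ "nat a"]) simp_all
  qed auto
  then have "card {a \<in> {a. a > 0 \<and> P (nat a)}. a\<^sup>2 = int m} = of_bool (\<exists>n. (n > 0 \<and> P n) \<and> m = n\<^sup>2)"
    by (simp only: card_image[OF inj_on_of_nat] card_square_roots)
  then show ?thesis by (simp only: theta_def fps_nth_Abs_fps of_nat_of_bool)
qed

lemma F_eq_theta: "F = theta {a. a > 0 \<and> odd a}"
proof -
  have "{a :: int. a > 0 \<and> odd a} = {a. a > 0 \<and> odd (nat a)}"
    by (auto simp: even_nat_iff)
  moreover have "n > 0 \<and> odd n \<longleftrightarrow> odd n" for n :: nat
    by (auto intro: odd_pos)
  ultimately show ?thesis
    by (intro fps_ext) (simp only: nth_theta_positive[of odd] F_def fps_nth_Abs_fps)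
qed

text \<open>The classes of \<open>i\<close> and \<open>- i\<close> are distinct and omit 0, so
  \<open>abs\<close> is injective on the class of \<open>i\<close> and maps it onto the positive
  members of both.\<close>

lemma residue_theta_eq_positive:
  assumes "m > 0" "\<not> m dvd 2 * i"
  shows "residue_theta m i = theta {a. a > 0 \<and> ([a = i] (mod m) \<or> [a = - i] (mod m))}"
proof -
  have neg: "[- a = i] (mod m) \<longleftrightarrow> [a = - i] (mod m)" for a
    by (metis cong_minus_minus_iff minus_minus)
  have nz: "\<not> [0 = i] (mod m)"
    using assms by (auto simp: cong_iff_dvd_diff)
  have ne: "\<not> ([a = i] (mod m) \<and> [a = - i] (mod m))" for a
  proof
    assume "[a = i] (mod m) \<and> [a = - i] (mod m)"
    then have "[i = - i] (mod m)" by (metis cong_sym cong_trans)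
    with assms show False by (simp add: cong_iff_dvd_diff)
  qed
  have "inj_on abs {a. [a = i] (mod m)}"
    using ne neg by (auto simp: inj_on_def abs_eq_iff)
  moreover have "abs ` {a. [a = i] (mod m)} = {a. a > 0 \<and> ([a = i] (mod m) \<or> [a = - i] (mod m))}"
  proof (intro equalityI subsetI)
    fix a assume "a \<in> {a. a > 0 \<and> ([a = i] (mod m) \<or> [a = - i] (mod m))}"
    then have "a = \<bar>a\<bar>" "a = \<bar>- a\<bar>" "[a = i] (mod m) \<or> [- a = i] (mod m)" using neg by auto
    then show "a \<in> abs ` {a. [a = i] (mod m)}" by blast
  next
    fix a assume "a \<in> abs ` {a. [a = i] (mod m)}"
    then obtain b where b: "[b = i] (mod m)" "a = \<bar>b\<bar>" by auto
    then have "b \<noteq> 0" using nz by auto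
    with b neg[of a] show "a \<in> {a. a > 0 \<and> ([a = i] (mod m) \<or> [a = - i] (mod m))}"
      by (auto simp: abs_if split: if_splits)
  qed
  ultimately show ?thesis
    by (metis residue_theta_def theta_abs)
qed

lemma F_split: "F = theta1 + theta3 + V 5 G"
proof -
  have "{a :: int. a > 0 \<and> odd a} = {a. a > 0 \<and> ([a = 1] (mod 10) \<or> [a = - 1] (mod 10))}
      \<union> ({a. a > 0 \<and> ([a = 3] (mod 10) \<or> [a = - 3] (mod 10))} \<union> (*) (int 5) ` {a. a > 0 \<and> odd a})"
    (is "?L = ?R1 \<union> (?R2 \<union> ?R3)")
  proof -
    have "?R3 = {a. a > 0 \<and> a mod 10 = 5}"
    proof (intro equalityI subsetI)
      fix a :: int assume "a \<in> {a. a > 0 \<and> a mod 10 = 5}"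
      then have "a = 5 * (a div 5)" "a div 5 > 0" "odd (a div 5)" by (simp, presburger)+
      then show "a \<in> ?R3" by (metis (mono_tags, lifting) image_eqI mem_Collect_eq of_nat_numeral)
    next
      fix a assume "a \<in> ?R3"
      then obtain b :: int where "a = 5 * b" "b > 0" "odd b" by auto
      then show "a \<in> {a. a > 0 \<and> a mod 10 = 5}" by (simp, presburger)
    qed
    moreover have "odd a \<longleftrightarrow> (a mod 10 = 1 \<or> a mod 10 = 9) \<or> (a mod 10 = 3 \<or> a mod 10 = 7) \<or> a mod 10 = 5" for a :: int
      by presburger
    ultimately show ?thesis by (auto simp: cong_def)
  qed
  then have "F = theta (?R1 \<union> (?R2 \<union> ?R3))"
    unfolding F_eq_theta by (rule arg_cong)
  moreover have "?R1 \<inter> (?R2 \<union> ?R3) = {}" "?R2 \<inter> ?R3 = {}"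
    by (auto simp: cong_def) presburger+
  ultimately have "F = theta ?R1 + (theta ?R2 + theta ?R3)"
    by (simp only: theta_Un)
  \<comment> \<open>Scaling the roots by 5 scales the exponents by 25, so the odd multiples of 5
    contribute \<open>V 25 F\<close>.\<close>
  moreover have "theta ?R3 = V 5 G"
    using theta_scale[of 5] by (simp add: F_eq_theta G_eq V_V)
  ultimately show ?thesis
    using residue_theta_eq_positive[of 10 1] residue_theta_eq_positive[of 10 3]
    by (simp add: theta1_def theta3_def add.assoc)
qed

lemma nth_0_F [simp]: "fps_nth F 0 = 0"
  by (auto simp: F_def)

lemma nth_0_G [simp]: "fps_nth G 0 = 0"
  by (simp add: G_def)

lemma nth_0_residue_theta: "\<not> m dvd i \<Longrightarrow> fps_nth (residue_theta m i) 0 = 0"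
proof -
  assume "\<not> m dvd i"
  then have "{a \<in> {a. [a = i] (mod m)}. a\<^sup>2 = int 0} = {}" by (auto simp: cong_iff_dvd_diff)
  then show ?thesis by (simp only: residue_theta_def theta_def fps_nth_Abs_fps card.empty of_nat_0)
qed

lemma theta1_mult_theta3: "theta1 * theta3 = G ^ 2 + V 5 G ^ 2"
proof -
  \<comment> \<open>Squaring \<open>F_split\<close> expresses the squares in the dissection of
    \<open>theta1 * theta3\<close> through \<open>F\<close> and \<open>G\<close>.\<close>
  have "F ^ 2 = theta1 ^ 2 + theta3 ^ 2 + V 5 G ^ 2"
    by (simp add: F_split bit_fps_square_add)
  then have "V 5 (theta1 ^ 2 + theta3 ^ 2) = V 5 (F ^ 2 + V 5 G ^ 2)"
    by (simp add: ac_simps)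
  then have AB: "V 5 (theta1 ^ 2 + theta3 ^ 2) = G ^ 2 + V 5 (V 5 G ^ 2)"
    by (simp add: V_add V_power G_eq)
  \<comment> \<open>The discrepancy between the two sides of the claim is fixed by
    \<open>V 5\<close>.\<close>
  have "theta1 * theta3 + (G ^ 2 + V 5 G ^ 2)
      = V 5 (theta1 ^ 2 + theta3 ^ 2) + V 5 (theta1 * theta3) + (G ^ 2 + V 5 G ^ 2)"
    by (subst theta1_mult_theta3_dissection) (simp add: V_add)
  also have "\<dots> = V 5 (theta1 * theta3 + (G ^ 2 + V 5 G ^ 2))"
    unfolding AB by (simp add: V_add V_power ac_simps)
  finally have "theta1 * theta3 + (G ^ 2 + V 5 G ^ 2) = 0"
    by (intro V_fixed_imp_const[of 5])
      (simp_all add: theta1_def nth_0_residue_theta V_nth fps_power_zeroth)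
  then show ?thesis by (simp add: bit_fps_add_eq_0)
qed

text \<open>Both sides solve \<open>Y = V 5 (theta1 + theta3 + V 5 Y)\<close>: the left one by the
  dissection, and \<open>G\<close> because \<open>G = V 5 F\<close> and \<open>F\<close> splits.
  Their sum is therefore fixed by \<open>V 25\<close>.\<close>

lemma theta_power5: "theta1 ^ 5 + theta3 ^ 5 = G"
proof -
  let ?Z = "theta1 ^ 5 + theta3 ^ 5"
  have "?Z + G = V 5 (theta1 + theta3 + V 5 ?Z) + V 5 (theta1 + theta3 + V 5 G)"
    using theta_power5_dissection F_split G_eq by metis
  also have "\<dots> = V 25 (?Z + G)"
    by (simp add: V_add V_V ac_simps)
  finally have "?Z + G = 0"
    by (intro V_fixed_imp_const[of 25]) (simp_all add: theta1_def theta3_def nth_0_residue_theta fps_power_zeroth)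
  then show ?thesis by (simp add: bit_fps_add_eq_0)
qed

lemma level5_relation: "(F + G) ^ 6 = F * G"
proof -
  let ?g = "V 5 G"
  have sq: "(F + G) ^ 2 = theta1 ^ 2 + theta1 * theta3 + theta3 ^ 2"
    by (simp add: F_split bit_fps_square_add theta1_mult_theta3 ac_simps)
  have "(F + G) ^ 6 = ((F + G) ^ 2) ^ 3"
    by (simp flip: power_mult)
  \<comment> \<open>The cube is written over the integers, with all even coefficients collected in
    the multiple of 2, so that what remains is expressible by the two known symmetric
    combinations.\<close>
  also have "\<dots> = (theta1 + theta3) * (theta1 ^ 5 + theta3 ^ 5) + (theta1 * theta3) ^ 3
      + 2 * (theta1 ^ 5 * theta3 + 3 * theta1 ^ 4 * theta3 ^ 2 + 3 * theta1 ^ 3 * theta3 ^ 3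
          + 3 * theta1 ^ 2 * theta3 ^ 4 + theta1 * theta3 ^ 5)"
    unfolding sq by algebra
  also have "\<dots> = (theta1 + theta3) * G + (G ^ 2 + ?g ^ 2) ^ 3"
    by (simp add: theta_power5 theta1_mult_theta3)
  also have "(G ^ 2 + ?g ^ 2) ^ 3 = (G + ?g) ^ 6"
    by (simp flip: power_mult bit_fps_square_add)
  finally have 1: "(F + G) ^ 6 = (theta1 + theta3) * G + (G + ?g) ^ 6" .
  \<comment> \<open>The part \<open>theta1 + theta3\<close> of \<open>F\<close> cancels, and the
    result is the same expression with \<open>(F, G)\<close> replaced by \<open>(G, V 5 G)\<close>,
    its image under \<open>V 5\<close>.\<close>
  have "(F + G) ^ 6 + F * G = (G + ?g) ^ 6 + G * ?g"
    unfolding 1 by (subst F_split) (simp add: algebra_simps)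
  also have "\<dots> = V 5 ((F + G) ^ 6 + F * G)"
    by (simp add: V_add V_mult V_power G_eq)
  finally have "(F + G) ^ 6 + F * G = 0"
    by (intro V_fixed_imp_const[of 5]) (simp_all add: fps_power_zeroth)
  then show ?thesis by (simp add: bit_fps_add_eq_0)
qed

text \<open>With \<open>R0\<close> the series of all positive squares, splitting by parity gives
  \<open>F = R0 + V 4 R0\<close>. As \<open>r ^ 2 = V 2 r\<close>, the terms \<open>V 2 R0\<close>
  and \<open>V 10 R0\<close> cancel in \<open>r + r ^ 2\<close>.\<close>

lemma F_plus_G: "F + G = r + r ^ 2"
proof -
  define R0 where "R0 = theta {a. a > 0}"
  have R0: "fps_nth R0 m = of_bool (\<exists>n::nat. n > 0 \<and> m = n\<^sup>2)" for m
    using nth_theta_positive[of "\<lambda>_. True" m] by (simp add: R0_def)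
  have V_R0: "fps_nth (V k R0) m = of_bool (\<exists>n::nat. n > 0 \<and> m = k * n\<^sup>2)" if "k > 0" for k m
    using that by (cases "k dvd m") (force simp: V_nth R0 elim!: dvdE)+
  have r_eq: "r = R0 + V 2 R0 + V 5 R0 + V 10 R0"
    by (rule fps_ext) (simp add: r_def R0 V_R0)
  have "{a :: int. a > 0} = {a. a > 0 \<and> odd a} \<union> (*) (int 2) ` {a. a > 0}"
    by (auto elim!: evenE)
  moreover have "{a. a > 0 \<and> odd a} \<inter> (*) (int 2) ` {a. a > 0} = {}" by auto
  ultimately have "R0 = F + theta ((*) (int 2) ` {a. a > 0})"
    unfolding F_eq_theta R0_def by (metis theta_Un)
  also have "theta ((*) (int 2) ` {a. a > 0}) = V 4 R0"
    using theta_scale[of 2] by (simp add: R0_def)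
  finally have "R0 = F + V 4 R0" .
  then have F: "F = R0 + V 4 R0" by (metis add.commute bit_fps_add_self')
  show ?thesis
    unfolding bit_fps_square G_eq F r_eq by (simp add: V_add V_V ac_simps)
qed

lemma G_eq_r: "G = r ^ 5 * (r + 1)"
proof -
  let ?s = "r + r ^ 2"
  have F: "F = G + ?s" using F_plus_G by (metis add.commute bit_fps_add_self')
  have "G * (G + ?s) = ?s ^ 6"
    using level5_relation unfolding F_plus_G by (simp add: F ac_simps)
  \<comment> \<open>Factorisation of the quadratic equation for \<open>G\<close>, as an identity
    over the integers with the even terms set apart.\<close>
  moreover have "(G - r ^ 5 * (r + 1)) * (G - r * (r + 1) ^ 5)
      = G * (G + ?s) - ?s ^ 6
        - 2 * (G * (r + 3 * r ^ 2 + 5 * r ^ 3 + 5 * r ^ 4 + 3 * r ^ 5 + r ^ 6) - ?s ^ 6)"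
    by algebra
  ultimately have "(G - r ^ 5 * (r + 1)) * (G - r * (r + 1) ^ 5) = 0"
    by simp
  \<comment> \<open>The coefficient of \<open>x\<close> selects the root:
    \<open>r * (r + 1) ^ 5\<close> begins with \<open>x\<close>, whereas \<open>G\<close> involves
    only powers of \<open>x ^ 5\<close>.\<close>
  moreover have "G \<noteq> r * (r + 1) ^ 5"
  proof
    assume eq: "G = r * (r + 1) ^ 5"
    have r0: "fps_nth r 0 = 0" and r1: "fps_nth r 1 = 1" by (auto simp: r_def)
    have "fps_nth (r * (r + 1) ^ 5) 1 = fps_nth r 1"
      using r0 by (simp add: fps_mult_nth fps_power_zeroth)
    moreover have "fps_nth G 1 = 0" by (simp add: G_def)
    ultimately show False using eq r1 by simp
  qed
  ultimately show ?thesis by simp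
qed

lemma F_eq_r: "F = r * (r + 1) ^ 5"
proof -
  have "F = G + (r + r ^ 2)" using F_plus_G by (metis add.commute bit_fps_add_self')
  also have "\<dots> = r * (r + 1) ^ 5 + 2 * (- 2 * r ^ 5 - 5 * r ^ 4 - 5 * r ^ 3 - 2 * r ^ 2)"
    unfolding G_eq_r by algebra
  finally show ?thesis by simp
qed

section \<open>Polygamma functions and the Lipschitz formula\<close>

lemma not_nonpos_Ints:
  fixes z :: complex
  assumes "z \<notin> \<int>"
  shows "z \<notin> \<int>\<^sub>\<le>\<^sub>0" "1 - z \<notin> \<int>\<^sub>\<le>\<^sub>0"
proof -
  show "z \<notin> \<int>\<^sub>\<le>\<^sub>0" using assms nonpos_Ints_Int by blast
  have "1 - (1 - z) \<in> \<int>" if "1 - z \<in> \<int>\<^sub>\<le>\<^sub>0"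
    using that nonpos_Ints_Int by (intro Ints_diff) auto
  with assms show "1 - z \<notin> \<int>\<^sub>\<le>\<^sub>0" by auto
qed

text \<open>Derivative of Euler's reflection formula
  \<open>rGamma z * rGamma (1 - z) = sin (pi * z) / pi\<close>, divided by the formula
  itself.\<close>

lemma Digamma_reflection:
  fixes z :: complex
  assumes "z \<notin> \<int>"
  shows "Digamma z - Digamma (1 - z) = - pi * cot (pi * z)"
proof -
  have "((\<lambda>z. rGamma z * rGamma (1 - z)) has_field_derivative
      (- rGamma z * Digamma z) * rGamma (1 - z) + rGamma z * (rGamma (1 - z) * Digamma (1 - z))) (at z)"
    using not_nonpos_Ints[OF assms] by (auto intro!: derivative_eq_intros simp: algebra_simps)
  moreover have "((\<lambda>z. sin (pi * z) / pi) has_field_derivative cos (pi * z)) (at z)"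
    by (auto intro!: derivative_eq_intros)
  ultimately have "(- rGamma z * Digamma z) * rGamma (1 - z) + rGamma z * (rGamma (1 - z) * Digamma (1 - z))
      = cos (pi * z)"
    unfolding rGamma_reflection_complex by (rule DERIV_unique)
  then have "(rGamma z * rGamma (1 - z)) * (Digamma (1 - z) - Digamma z) = cos (pi * z)"
    by (simp add: algebra_simps)
  then have "sin (pi * z) * (Digamma (1 - z) - Digamma z) = pi * cos (pi * z)"
    unfolding rGamma_reflection_complex by (simp add: field_simps)
  moreover have "sin (pi * z) \<noteq> 0"
    using assms by (auto simp: sin_eq_0 mult.commute)
  ultimately show ?thesis
    by (simp add: cot_def field_simps)
qed

lemma open_not_Ints: "open (- (\<int> :: complex set))"
  by (simp add: closed_Ints open_Compl)

lemma has_field_derivative_Polygamma_sum: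
  fixes z :: complex
  assumes "z \<notin> \<int>"
  shows "((\<lambda>z. Polygamma j z + (-1) ^ Suc j * Polygamma j (1 - z)) has_field_derivative
      Polygamma (Suc j) z + (-1) ^ Suc (Suc j) * Polygamma (Suc j) (1 - z)) (at z)"
  using not_nonpos_Ints[OF assms] by (auto intro!: derivative_eq_intros)

text \<open>The iterated derivatives of \<open>- cot\<close> as polynomials in \<open>cot\<close>,
  by \<open>cot' = - (1 + cot ^ 2)\<close>.\<close>

fun cot_poly :: "nat \<Rightarrow> complex poly" where
  "cot_poly 0 = [:0, -1:]"
| "cot_poly (Suc j) = - [:1, 0, 1:] * pderiv (cot_poly j)"

text \<open>Repeated differentiation of the digamma case. Derivatives may be compared because the
  induction hypothesis holds on the open complement of the integers.\<close>

lemma Polygamma_reflection_cot: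
  fixes z :: complex
  assumes "z \<notin> \<int>"
  shows "Polygamma j z + (-1) ^ Suc j * Polygamma j (1 - z) = pi ^ Suc j * poly (cot_poly j) (cot (pi * z))"
  using assms
proof (induction j arbitrary: z)
  case 0
  then show ?case using Digamma_reflection[OF 0] by simp
next
  case (Suc j)
  let ?f = "\<lambda>z. of_real pi ^ Suc j * poly (cot_poly j) (cot (of_real pi * z)) :: complex"
  have sin: "sin (of_real pi * z) \<noteq> 0"
    using Suc.prems by (auto simp: sin_eq_0 mult.commute)
  have "inverse ((sin (of_real pi * z))\<^sup>2) = 1 + (cot (of_real pi * z))\<^sup>2"
    using sin sin_cos_squared_add[of "of_real pi * z"] by (simp add: cot_def field_simps)
  then have "(?f has_field_derivative of_real pi ^ Suc (Suc j) * poly (cot_poly (Suc j)) (cot (of_real pi * z))) (at z)"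
    using sin by (auto intro!: derivative_eq_intros DERIV_chain2[OF DERIV_cot] simp: power2_eq_square algebra_simps)
  then have "((\<lambda>z. Polygamma j z + (-1) ^ Suc j * Polygamma j (1 - z)) has_field_derivative
     of_real pi ^ Suc (Suc j) * poly (cot_poly (Suc j)) (cot (of_real pi * z))) (at z)"
    by (rule DERIV_cong_ev[THEN iffD1, rotated 3])
       (use Suc open_not_Ints in \<open>auto simp: eventually_nhds intro!: exI[of _ "- \<int>"]\<close>)
  with has_field_derivative_Polygamma_sum[OF Suc.prems, of j] show ?case
    unfolding of_real_power by (rule DERIV_unique)
qed

section \<open>Expansions in the nome\<close>

definition nome :: "complex \<Rightarrow> complex" where
  "nome z = exp (2 * pi * \<i> * z)"

lemma nome_nz [simp]: "nome z \<noteq> 0" by (simp add: nome_def)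

lemma norm_nome: "norm (nome z) = exp (- 2 * pi * Im z)"
  by (simp add: nome_def norm_exp_eq_Re)

lemma norm_nome_less_1: "Im z > 0 \<Longrightarrow> norm (nome z) < 1"
  by (simp add: norm_nome)

lemma nome_power: "nome z ^ n = nome (of_nat n * z)"
  by (simp add: nome_def exp_of_nat_mult[symmetric] mult_ac)

lemma summable_powser_power:
  fixes q :: "'a :: {real_normed_field, banach}"
  assumes "norm q < 1"
  shows "summable (\<lambda>n. of_nat n ^ j * q ^ n)"
  using assms
proof (induction j arbitrary: q)
  case (Suc j)
  have "summable (\<lambda>n. diffs (\<lambda>n. of_nat n ^ j) n * q ^ n)"
    by (rule termdiff_converges[OF Suc.prems Suc.IH])
  then have "summable (\<lambda>n. q * (diffs (\<lambda>n. of_nat n ^ j) n * q ^ n))"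
    by (rule summable_mult)
  then have "summable (\<lambda>n. of_nat (Suc n) ^ Suc j * q ^ Suc n)"
    by (simp add: diffs_def mult_ac del: of_nat_Suc)
  then show ?case by (subst (asm) summable_Suc_iff)
qed (simp add: summable_geometric)

text \<open>The polylogarithm of order \<open>- j\<close>, except for \<open>j = 0\<close>: there
  \<open>0 ^ 0 = 1\<close> adds a constant term and the value is \<open>1 / (1 - q)\<close>.\<close>

definition power_lambert :: "nat \<Rightarrow> complex \<Rightarrow> complex" where
  "power_lambert j q = (\<Sum>n. of_nat n ^ j * q ^ n)"

lemma power_lambert_deriv:
  assumes "norm q < 1" "q \<noteq> 0"
  shows "(power_lambert j has_field_derivative power_lambert (Suc j) q / q) (at q)"
proof -
  let ?d = "\<lambda>n. diffs (\<lambda>n. of_nat n ^ j) n * q ^ n"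
  have "summable ?d"
    by (rule termdiff_converges[OF assms(1) summable_powser_power])
  then have "(\<lambda>n. q * ?d n) sums (q * suminf ?d)"
    by (intro sums_mult summable_sums)
  then have "(\<lambda>n. of_nat (Suc n) ^ Suc j * q ^ Suc n) sums (q * suminf ?d)"
    by (simp add: diffs_def mult_ac del: of_nat_Suc)
  then have "(\<lambda>n. of_nat n ^ Suc j * q ^ n) sums (q * suminf ?d)"
    by (subst (asm) sums_Suc_iff) simp
  then have "power_lambert (Suc j) q = q * suminf ?d"
    unfolding power_lambert_def by (rule sums_unique[symmetric])
  moreover have "((\<lambda>q. \<Sum>n. of_nat n ^ j * q ^ n) has_field_derivative suminf ?d) (at q)"
    by (rule termdiffs_strong'[OF summable_powser_power assms(1)])
  ultimately show ?thesis
    using assms(2) by (simp add: power_lambert_def[abs_def])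
qed

lemma Ints_Im: "z \<in> \<int> \<Longrightarrow> Im z = 0"
  by (auto elim: Ints_cases)

text \<open>For \<open>j = 0\<close>, \<open>- pi * cot (pi * z)\<close> is rational in
  \<open>q = nome z\<close>, namely \<open>2 * pi * \<i> / (1 - q) - pi * \<i>\<close>.
  Differentiation in \<open>z\<close> is \<open>2 * pi * \<i>\<close> times \<open>q d/dq\<close>,
  which raises the index of \<open>power_lambert\<close> by one; the additive constant survives only
  at \<open>j = 0\<close>.\<close>

lemma Polygamma_reflection_nome:
  assumes "Im z > 0"
  shows "Polygamma j z + (-1) ^ Suc j * Polygamma j (1 - z)
       = (2 * pi * \<i>) ^ Suc j * power_lambert j (nome z) - (if j = 0 then pi * \<i> else 0)"
  using assms
proof (induction j arbitrary: z)
  case 0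
  define q where "q = nome z"
  have q: "norm q < 1" "q \<noteq> 1" using norm_nome_less_1[OF 0] by (auto simp: q_def)
  have exp2: "exp (\<i> * (of_real pi * z)) ^ 2 = q" "exp (- (\<i> * (of_real pi * z))) * exp (\<i> * (of_real pi * z)) = 1"
    by (simp_all add: q_def nome_def mult_ac flip: exp_double exp_add)
  define w where "w = exp (\<i> * (of_real pi * z))"
  have w: "w ^ 2 = q" "exp (- (\<i> * (of_real pi * z))) = 1 / w" "w \<noteq> 0"
    using exp2 by (simp_all add: w_def exp_minus field_simps)
  have "cot (of_real pi * z) = - \<i> * (1 + q) / (1 - q)"
  proof -
    have "cos (of_real pi * z) = (w + 1 / w) / 2" "sin (of_real pi * z) = (w - 1 / w) / (2 * \<i>)"
      using w(2) unfolding cos_exp_eq sin_exp_eq by (simp_all add: w_def)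
    moreover have "w - 1 / w = (q - 1) / w" "w + 1 / w = (q + 1) / w"
      using w by (simp_all add: field_simps power2_eq_square)
    ultimately have "cot (of_real pi * z) = ((q + 1) / w / 2) / ((q - 1) / w / (2 * \<i>))"
      by (simp only: cot_def)
    also have "\<dots> = \<i> * (q + 1) / (q - 1)"
      using w(3) q by (simp add: divide_simps)
    also have "\<dots> = - \<i> * (1 + q) / (1 - q)"
      using q by (simp add: divide_simps) (simp add: algebra_simps)
    finally show ?thesis .
  qed
  moreover have "Digamma z - Digamma (1 - z) = - pi * cot (pi * z)"
    using 0 by (intro Digamma_reflection) (auto dest: Ints_Im)
  moreover have "power_lambert 0 q = 1 / (1 - q)"
    using q by (simp add: power_lambert_def suminf_geometric)
  moreover have "- of_real pi * (- \<i> * (1 + q) / (1 - q)) = 2 * of_real pi * \<i> * (1 / (1 - q)) - of_real pi * \<i>"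
    using q by (simp add: divide_simps) (simp add: algebra_simps)
  ultimately show ?case
    by (simp only: q_def[symmetric]) simp
next
  case (Suc j)
  have "(nome has_field_derivative 2 * pi * \<i> * nome z) (at z)"
    unfolding nome_def by (auto intro!: derivative_eq_intros)
  from DERIV_chain2[OF power_lambert_deriv this]
  have "((\<lambda>z. (2 * pi * \<i>) ^ Suc j * power_lambert j (nome z) - (if j = 0 then pi * \<i> else 0)) has_field_derivative
      (2 * pi * \<i>) ^ Suc (Suc j) * power_lambert (Suc j) (nome z) - (if Suc j = 0 then pi * \<i> else 0)) (at z)"
    using Suc.prems norm_nome_less_1 by (auto intro!: derivative_eq_intros simp: field_simps)
  then have "((\<lambda>z. Polygamma j z + (-1) ^ Suc j * Polygamma j (1 - z)) has_field_derivative
      (2 * pi * \<i>) ^ Suc (Suc j) * power_lambert (Suc j) (nome z) - (if Suc j = 0 then pi * \<i> else 0)) (at z)"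
    by (rule DERIV_cong_ev[THEN iffD1, rotated 3])
       (use Suc open_halfspace_Im_gt[of 0] in \<open>auto simp: eventually_nhds intro!: exI[of _ "{z. Im z > 0}"]\<close>)
  moreover have "z \<notin> \<int>" using Suc.prems by (auto dest: Ints_Im)
  ultimately show ?case
    using has_field_derivative_Polygamma_sum DERIV_unique by blast
qed

text \<open>The negative integers are listed as \<open>- 1 - int n\<close> because
  \<open>w + (- 1 - n) = - (1 - w + n)\<close>, which matches the polygamma series at
  \<open>1 - w\<close>.\<close>

lemma has_sum_int:
  assumes "((\<lambda>n. f (int n)) has_sum a) UNIV" "((\<lambda>n. f (- 1 - int n)) has_sum b) UNIV"
  shows "(f has_sum (a + b :: 'a :: {topological_comm_monoid_add, t2_space})) UNIV"
proof -
  have "(f has_sum a) {0..}"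
    using assms(1) by (rule has_sum_reindex_bij_witness[of _ nat int, THEN iffD1, rotated -1]) auto
  moreover have "(f has_sum b) {..<0}"
    using assms(2)
    by (rule has_sum_reindex_bij_witness[of _ "\<lambda>n. nat (- 1 - n)" "\<lambda>n. - 1 - int n", THEN iffD1, rotated -1]) auto
  ultimately have "(f has_sum (a + b)) ({0..} \<union> {..<0})"
    by (intro has_sum_Un_disjoint) auto
  also have "{0..} \<union> {..<0} = (UNIV :: int set)" by auto
  finally show ?thesis .
qed

text \<open>One factor of the majorant for lattice sums; the summand \<open>1 +\<close> keeps it
  meaningful on the axes, where a coordinate is 0.\<close>

lemma summable_on_inverse_Suc_square: "(\<lambda>n :: int. 1 / (1 + real_of_int n ^ 2)) summable_on UNIV"
proof -
  have *: "((\<lambda>n :: nat. 1 / (1 + x n ^ 2)) summable_on UNIV)" if "\<And>n. x n \<ge> real n" for x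
  proof (rule summable_on_comparison_test)
    have "summable (\<lambda>n. 1 / (1 + real n ^ 2))"
    proof (rule summable_comparison_test_ev)
      show "summable (\<lambda>n. inverse (real n ^ 2))" using inverse_power_summable[of 2] by simp
      show "\<forall>\<^sub>F n in sequentially. norm (1 / (1 + real n ^ 2)) \<le> inverse (real n ^ 2)"
        using eventually_gt_at_top[of 0]
        by eventually_elim (auto simp: inverse_eq_divide intro!: divide_left_mono mult_pos_pos add_pos_nonneg)
    qed
    then show "(\<lambda>n. 1 / (1 + real n ^ 2)) summable_on UNIV"
      by (rule summable_nonneg_imp_summable_on) simp
    show "1 / (1 + x n ^ 2) \<le> 1 / (1 + real n ^ 2)" for n
      by (intro divide_left_mono add_left_mono power_mono that) (auto simp: add_pos_nonneg)
  qed auto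
  have "(\<lambda>n. 1 / (1 + real_of_int (int n) ^ 2)) summable_on UNIV"
    using *[of real] by simp
  moreover have "(\<lambda>n. 1 / (1 + real_of_int (- 1 - int n) ^ 2)) summable_on UNIV"
    using *[of "\<lambda>n. 1 + real n"] by (simp add: power2_eq_square algebra_simps)
  ultimately obtain a b where "((\<lambda>n. 1 / (1 + real_of_int (int n) ^ 2)) has_sum a) UNIV"
    "((\<lambda>n. 1 / (1 + real_of_int (- 1 - int n) ^ 2)) has_sum b) UNIV"
    unfolding summable_on_def by blast
  then have "((\<lambda>n :: int. 1 / (1 + real_of_int n ^ 2)) has_sum (a + b)) UNIV"
    by (rule has_sum_int)
  then show ?thesis by (rule has_sum_imp_summable)
qed

section \<open>Eisenstein series\<close>

definition lattice :: "(int \<times> int) set" where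
  "lattice = - {(0, 0)}"

lemma summable_on_lattice_bound:
  "(\<lambda>(m, n). 1 / (1 + real_of_int m ^ 2) * (1 / (1 + real_of_int n ^ 2))) summable_on A"
proof -
  let ?f = "\<lambda>n :: int. 1 / (1 + real_of_int n ^ 2)"
  have "(\<lambda>(m, n). ?f m * ?f n) summable_on (UNIV \<times> UNIV)"
  proof (rule summable_on_SigmaI)
    show "((\<lambda>n. (case (m, n) of (m, n) \<Rightarrow> ?f m * ?f n)) has_sum ?f m * infsum ?f UNIV) UNIV" for m
      unfolding prod.case by (intro has_sum_cmult_right has_sum_infsum summable_on_inverse_Suc_square)
    show "(\<lambda>m. ?f m * infsum ?f UNIV) summable_on UNIV"
      by (intro summable_on_cmult_left summable_on_inverse_Suc_square)
  qed auto
  then show ?thesis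
    by (rule summable_on_subset) auto
qed

lemma norm_lattice_point_ge:
  assumes "Im z > 0"
  obtains c where "c > 0" "\<And>m n :: int. norm (of_int m * z + of_int n) ^ 2 \<ge> c * (of_int m ^ 2 + of_int n ^ 2)"
proof -
  define y where "y = Im z"
  \<comment> \<open>For \<open>w = m * z + n\<close>, the imaginary part bounds
    \<open>\<bar>m\<bar>\<close> by \<open>norm w / y\<close>, and then the real part bounds
    \<open>\<bar>n\<bar>\<close> by \<open>(1 + \<bar>Re z\<bar> / y) * norm w\<close>;
    \<open>K\<close> adds the squares of both factors.\<close>
  define K where "K = (1 + \<bar>Re z\<bar> / y) ^ 2 + 1 / y ^ 2"
  have y: "y > 0" using assms by (simp add: y_def)
  have K: "K > 0" unfolding K_def using y by (intro add_nonneg_pos) auto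
  have "of_int m ^ 2 + of_int n ^ 2 \<le> K * norm (of_int m * z + of_int n) ^ 2" for m n :: int
  proof -
    define w where "w = of_int m * z + of_int n"
    have "\<bar>Im w\<bar> \<le> norm w" by (rule abs_Im_le_cmod)
    then have m: "\<bar>of_int m\<bar> \<le> norm w / y"
      using y by (simp add: w_def abs_mult field_simps flip: y_def)
    have "of_int n = Re w - of_int m * Re z" by (simp add: w_def)
    then have "\<bar>of_int n\<bar> \<le> \<bar>Re w\<bar> + \<bar>of_int m\<bar> * \<bar>Re z\<bar>" by (simp add: abs_mult[symmetric])
    also have "\<dots> \<le> norm w + norm w / y * \<bar>Re z\<bar>"
      by (intro add_mono abs_Re_le_cmod mult_right_mono m) auto
    finally have n: "\<bar>of_int n\<bar> \<le> (1 + \<bar>Re z\<bar> / y) * norm w" by (simp add: field_simps)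
    have "of_int n ^ 2 \<le> ((1 + \<bar>Re z\<bar> / y) * norm w) ^ 2"
      using n by (metis abs_ge_zero power2_abs power_mono)
    moreover have "of_int m ^ 2 \<le> (norm w / y) ^ 2"
      using m by (metis abs_ge_zero power2_abs power_mono)
    ultimately have "of_int m ^ 2 + of_int n ^ 2 \<le> (norm w / y) ^ 2 + ((1 + \<bar>Re z\<bar> / y) * norm w) ^ 2"
      by (rule add_mono[rotated])
    also have "\<dots> = K * norm w ^ 2"
      unfolding K_def by (subst power_mult_distrib) (simp only: power_divide distrib_right, simp)
    finally show ?thesis unfolding w_def .
  qed
  then show ?thesis
    using K by (intro that[of "1 / K"]) (simp_all add: field_simps)
qed

lemma lattice_abs_summable:
  assumes "Im z > 0" "k \<ge> 4"
  shows "(\<lambda>p. norm (case p of (m, n) \<Rightarrow> inverse ((of_int m * z + of_int n) ^ k))) summable_on lattice"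
proof -
  obtain c where c: "c > 0" "\<And>m n :: int. norm (of_int m * z + of_int n) ^ 2 \<ge> c * (of_int m ^ 2 + of_int n ^ 2)"
    using norm_lattice_point_ge[OF assms(1)] by blast
  have "(\<lambda>(m, n). 3 / sqrt c ^ k * (1 / (1 + real_of_int m ^ 2) * (1 / (1 + real_of_int n ^ 2)))) summable_on lattice"
    using summable_on_cmult_right[OF summable_on_lattice_bound, of "3 / sqrt c ^ k"] by (simp only: case_prod_unfold)
  moreover have "norm (case p of (m, n) \<Rightarrow> inverse ((of_int m * z + of_int n) ^ k))
     \<le> (case p of (m, n) \<Rightarrow> 3 / sqrt c ^ k * (1 / (1 + real_of_int m ^ 2) * (1 / (1 + real_of_int n ^ 2))))"
    if "p \<in> lattice" for p
  proof (cases p)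
    case (Pair m n)
    define a b where "a = real_of_int m ^ 2" and "b = real_of_int n ^ 2"
    have "m\<^sup>2 + n\<^sup>2 \<ge> 1"
      using that Pair by (auto simp: lattice_def add_nonneg_pos add_pos_nonneg int_one_le_iff_zero_less)
    then have "real_of_int (m\<^sup>2 + n\<^sup>2) \<ge> 1" by (metis of_int_1_le_iff)
    then have ab: "a + b \<ge> 1" "a \<ge> 0" "b \<ge> 0" by (simp_all add: a_def b_def)
    \<comment> \<open>For \<open>s = a + b \<ge> 1\<close>, each of \<open>1\<close>,
      \<open>s\<close> and \<open>a * b\<close> is at most \<open>s ^ 2\<close>, whence the constant
      3. The exponent \<open>k \<ge> 4\<close> then dominates
      \<open>s ^ 2 = sqrt s ^ 4\<close>.\<close>
    have "(a + b) ^ 2 - 4 * a * b = (a - b) ^ 2" by algebra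
    moreover have "(a + b) ^ 2 \<ge> a + b" using ab by (simp add: power2_eq_square mult_le_cancel_left1)
    moreover have "(1 + a) * (1 + b) = 1 + (a + b) + a * b" by algebra
    ultimately have "(1 + a) * (1 + b) \<le> 3 * (a + b) ^ 2"
      using ab(1) zero_le_power2[of "a - b"] zero_le_power2[of "a + b"] by linarith
    also have "(a + b) ^ 2 = sqrt (a + b) ^ 4"
    proof -
      have "sqrt (a + b) ^ 4 = (sqrt (a + b) ^ 2) ^ 2" by (simp flip: power_mult)
      then show ?thesis using ab by simp
    qed
    also have "sqrt (a + b) ^ 4 \<le> sqrt (a + b) ^ k"
      using ab assms(2) by (intro power_increasing) auto
    finally have 1: "(1 + a) * (1 + b) \<le> 3 * sqrt (a + b) ^ k" by simp
    have "sqrt c * sqrt (a + b) \<le> norm (of_int m * z + of_int n)"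
      using c(2)[of m n] unfolding real_sqrt_mult[symmetric]
      by (intro real_le_lsqrt) (simp_all add: a_def b_def)
    then have 2: "(sqrt c * sqrt (a + b)) ^ k \<le> norm (of_int m * z + of_int n) ^ k"
      using c ab by (intro power_mono) auto
    have "sqrt c ^ k * ((1 + a) * (1 + b)) \<le> 3 * norm (of_int m * z + of_int n) ^ k"
    proof -
      have "sqrt c ^ k * ((1 + a) * (1 + b)) \<le> sqrt c ^ k * (3 * sqrt (a + b) ^ k)"
        using c(1) by (intro mult_left_mono 1) auto
      also have "\<dots> = 3 * (sqrt c * sqrt (a + b)) ^ k" by (simp add: power_mult_distrib)
      finally show ?thesis using 2 by linarith
    qed
    moreover have "norm (of_int m * z + of_int n) ^ k > 0"
      using calculation c ab by (smt (verit) mult_pos_pos real_sqrt_gt_zero zero_less_power)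
    moreover have "sqrt c ^ k * ((1 + a) * (1 + b)) > 0" using c(1) ab by simp
    moreover have "inverse x \<le> 3 / y" if "y \<le> 3 * x" "x > 0" "y > 0" for x y :: real
      using that by (simp add: field_simps)
    ultimately have "inverse (norm (of_int m * z + of_int n) ^ k) \<le> 3 / (sqrt c ^ k * ((1 + a) * (1 + b)))"
      by blast
    then show ?thesis
      using Pair by (simp add: a_def b_def norm_inverse norm_power mult.assoc)
  qed
  ultimately show ?thesis
    by (rule Infinite_Sum.abs_summable_on_comparison_test')
qed

definition Eis :: "nat \<Rightarrow> complex \<Rightarrow> complex" where
  "Eis k z = (\<Sum>\<^sub>\<infinity>(m, n)\<in>lattice. inverse ((of_int m * z + of_int n) ^ k))"

text \<open>Clearing denominators extracts the factor of automorphy and multiplies the row vector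
  \<open>(m, n)\<close> by the matrix, which permutes the nonzero lattice points; the inverse
  permutation comes from the adjugate matrix.\<close>

lemma Eis_modular:
  assumes "a * d - b * c = 1" "Im z > 0"
  shows "Eis k ((of_int a * z + of_int b) / (of_int c * z + of_int d)) = (of_int c * z + of_int d) ^ k * Eis k z"
proof -
  let ?j = "of_int c * z + of_int d :: complex"
  have j: "?j \<noteq> 0"
  proof
    assume *: "?j = 0"
    then have "Im ?j = 0" "Re ?j = 0" by (simp_all only: zero_complex.simps)
    with assms have "c = 0" "d = 0" by auto
    with assms(1) show False by simp
  qed
  have "Eis k ((of_int a * z + of_int b) / ?j)
      = (\<Sum>\<^sub>\<infinity>(m, n)\<in>lattice. ?j ^ k * inverse ((of_int (m * a + n * c) * z + of_int (m * b + n * d)) ^ k))"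
    unfolding Eis_def
  proof (intro infsum_cong, clarify)
    fix m n :: int
    have "of_int m * ((of_int a * z + of_int b) / ?j) + of_int n
        = (of_int (m * a + n * c) * z + of_int (m * b + n * d)) / ?j"
      using j by (simp add: field_simps)
    then show "inverse ((of_int m * ((of_int a * z + of_int b) / ?j) + of_int n) ^ k)
       = ?j ^ k * inverse ((of_int (m * a + n * c) * z + of_int (m * b + n * d)) ^ k)"
      by (simp add: power_divide field_simps)
  qed
  also have "\<dots> = ?j ^ k * (\<Sum>\<^sub>\<infinity>(m, n)\<in>lattice. inverse ((of_int (m * a + n * c) * z + of_int (m * b + n * d)) ^ k))"
    by (subst infsum_cmult_right'[symmetric]) (simp add: case_prod_unfold)
  also have "(\<Sum>\<^sub>\<infinity>(m, n)\<in>lattice. inverse ((of_int (m * a + n * c) * z + of_int (m * b + n * d)) ^ k)) = Eis k z"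
    unfolding Eis_def
  proof (rule infsum_reindex_bij_witness[of _ "\<lambda>(m, n). (m * d - n * c, n * a - m * b)"
        "\<lambda>(m, n). (m * a + n * c, m * b + n * d)"], goal_cases)
    case (1 p)
    obtain m n where p: "p = (m, n)" by (cases p)
    have "(m * a + n * c) * d - (m * b + n * d) * c = m * (a * d - b * c)"
      "(m * b + n * d) * a - (m * a + n * c) * b = n * (a * d - b * c)" by algebra+
    then show ?case by (simp add: p assms(1))
  next
    case (2 p)
    obtain m n where p: "p = (m, n)" by (cases p)
    have "m = 0 \<and> n = 0" if "m * a + n * c = 0" "m * b + n * d = 0"
    proof -
      have "m * (a * d - b * c) = (m * a + n * c) * d - (m * b + n * d) * c"
        "n * (a * d - b * c) = (m * b + n * d) * a - (m * a + n * c) * b" by algebra+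
      then show ?thesis unfolding that assms(1) by simp
    qed
    then show ?case using 2 by (auto simp: p lattice_def)
  next
    case (3 p)
    obtain m n where p: "p = (m, n)" by (cases p)
    have "(m * d - n * c) * a + (n * a - m * b) * c = m * (a * d - b * c)"
      "(m * d - n * c) * b + (n * a - m * b) * d = n * (a * d - b * c)" by algebra+
    then show ?case by (simp add: p assms(1))
  next
    case (4 p)
    obtain m n where p: "p = (m, n)" by (cases p)
    have "m = 0 \<and> n = 0" if "m * d - n * c = 0" "n * a - m * b = 0"
    proof -
      have "m * (a * d - b * c) = (m * d - n * c) * a + (n * a - m * b) * c"
        "n * (a * d - b * c) = (m * d - n * c) * b + (n * a - m * b) * d" by algebra+
      then show ?thesis unfolding that assms(1) by simp
    qed
    then show ?case using 4 by (auto simp: p lattice_def)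
  qed (auto simp: case_prod_unfold)
  finally show ?thesis .
qed

lemma lattice_summable:
  assumes "Im z > 0" "k \<ge> 4"
  shows "(\<lambda>(m, n). inverse ((of_int m * z + of_int n) ^ k)) summable_on lattice"
  using lattice_abs_summable[OF assms] by (rule abs_summable_summable)

lemma lattice_row_summable:
  assumes "Im z > 0" "k \<ge> 4" "m \<noteq> 0"
  shows "(\<lambda>n. inverse ((of_int m * z + of_int n) ^ k)) summable_on UNIV"
proof -
  have "(\<lambda>(m, n). inverse ((of_int m * z + of_int n) ^ k)) summable_on (SIGMA m:{m}. UNIV)"
    by (rule summable_on_subset_banach[OF lattice_summable[OF assms(1,2)]]) (use assms(3) in \<open>auto simp: lattice_def\<close>)
  then show ?thesis by (rule summable_on_SigmaD1) simp
qed

text \<open>The two halves of the sum are the polygamma series at \<open>w\<close> and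
  \<open>1 - w\<close>; as \<open>j\<close> is odd, the exponent is even and absorbs the sign in the
  negative half. Summability upgrades the ordered series to unordered sums.\<close>

lemma Polygamma_has_sum_int:
  fixes w :: complex
  assumes "(\<lambda>n :: int. inverse ((w + of_int n) ^ Suc j)) summable_on UNIV"
    and "w \<notin> \<int>" "odd j"
  shows "((\<lambda>n :: int. inverse ((w + of_int n) ^ Suc j)) has_sum
      (Polygamma j w + (-1) ^ Suc j * Polygamma j (1 - w)) / fact j) UNIV"
proof -
  let ?f = "\<lambda>n :: int. inverse ((w + of_int n) ^ Suc j)"
  have j: "j > 0" "even (Suc j)" using assms(3) by (auto intro: odd_pos)
  have w: "w \<noteq> 0" "1 - w \<noteq> 0" using assms(2) by auto
  have "(\<lambda>n. ?f (int n)) summable_on UNIV"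
    using summable_on_subset_banach[OF assms(1) subset_UNIV[of "range int"]]
    by (subst (asm) summable_on_reindex) (auto simp: o_def)
  moreover have "(\<lambda>n. ?f (int n)) sums (Polygamma j w / fact j)"
    using Polygamma_LIMSEQ[OF w(1) j(1)] j(2) by simp
  ultimately have 1: "((\<lambda>n. ?f (int n)) has_sum (Polygamma j w / fact j)) UNIV"
    by (metis has_sum_imp_sums has_sum_infsum sums_unique2)
  have "(\<lambda>n. ?f (- 1 - int n)) summable_on UNIV"
    using summable_on_subset_banach[OF assms(1) subset_UNIV[of "range (\<lambda>n. - 1 - int n)"]]
    by (subst (asm) summable_on_reindex) (auto simp: o_def inj_on_def)
  moreover have "?f (- 1 - int n) = inverse ((1 - w + of_nat n) ^ Suc j)" for n
  proof -
    have "w + of_int (- 1 - int n) = - (1 - w + of_nat n)" by simp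
    then show ?thesis using j(2) by (metis power_minus_even)
  qed
  then have "(\<lambda>n. ?f (- 1 - int n)) sums (Polygamma j (1 - w) / fact j)"
    using Polygamma_LIMSEQ[OF w(2) j(1)] j(2) by simp
  ultimately have "((\<lambda>n. ?f (- 1 - int n)) has_sum (Polygamma j (1 - w) / fact j)) UNIV"
    by (metis has_sum_imp_sums has_sum_infsum sums_unique2)
  from has_sum_int[OF 1 this] show ?thesis
    using j(2) by (simp add: add_divide_distrib)
qed

text \<open>The polygamma combination is evaluated twice, as a sum over the integers and as a power
  series in the nome. Summability is that of the lattice row \<open>m = 1\<close>.\<close>

lemma Lipschitz_formula:
  assumes "Im z > 0" "odd j" "j \<ge> 3"
  shows "((\<lambda>n :: int. inverse ((z + of_int n) ^ Suc j)) has_sum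
      (2 * pi * \<i>) ^ Suc j / fact j * power_lambert j (nome z)) UNIV"
proof -
  have "z \<notin> \<int>" using assms(1) by (auto dest: Ints_Im)
  with lattice_row_summable[of z "Suc j" 1]
  have "((\<lambda>n :: int. inverse ((z + of_int n) ^ Suc j)) has_sum
      (Polygamma j z + (-1) ^ Suc j * Polygamma j (1 - z)) / fact j) UNIV"
    using assms by (intro Polygamma_has_sum_int) auto
  moreover have "j \<noteq> 0" using assms(3) by simp
  ultimately show ?thesis
    unfolding Polygamma_reflection_nome[OF assms(1)] by simp
qed

text \<open>The substitution \<open>n = 2 * m\<close> or \<open>n = 2 * m + 1\<close> turns the row \<open>m = 0\<close> into the value at \<open>1 / 2\<close>.\<close>

lemma zeta_has_sum:
  assumes "odd j" "j \<ge> 3"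
  shows "((\<lambda>n :: int. inverse (of_int n ^ Suc j)) has_sum
      pi ^ Suc j * poly (cot_poly j) 0 / (fact j * (2 ^ Suc j - 1))) (- {0 :: int})"
proof -
  let ?f = "\<lambda>n :: int. inverse (of_int n ^ Suc j) :: complex"
  define Z where "Z = infsum ?f (- {0})"
  have "(\<lambda>(m, n). inverse ((of_int m * \<i> + of_int n) ^ Suc j)) summable_on (SIGMA m:{0}. - {0})"
    by (rule summable_on_subset_banach[OF lattice_summable[of \<i> "Suc j"]]) (use assms in \<open>auto simp: lattice_def\<close>)
  from summable_on_SigmaD1[OF this] have summ: "?f summable_on - {0}" by simp
  then have Z: "(?f has_sum Z) (- {0})" by (simp add: Z_def)
  have "((\<lambda>n. inverse (2 ^ Suc j) * ?f n) has_sum inverse (2 ^ Suc j) * Z) (- {0})"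
    by (rule has_sum_cmult_right[OF Z])
  also have "?this \<longleftrightarrow> (?f has_sum inverse (2 ^ Suc j) * Z) {n. even n \<and> n \<noteq> 0}"
    by (rule has_sum_reindex_bij_witness[of _ "\<lambda>n. n div 2" "\<lambda>n. 2 * n"]) (auto simp: power_mult_distrib)
  finally have even: "(?f has_sum inverse (2 ^ Suc j) * Z) {n. even n \<and> n \<noteq> 0}" .
  have "?f summable_on {n. odd n}"
    by (rule summable_on_subset_banach[OF summ]) auto
  also have "?this \<longleftrightarrow> (\<lambda>n. inverse (2 ^ Suc j) * inverse ((1 / 2 + of_int n :: complex) ^ Suc j)) summable_on UNIV"
    by (rule summable_on_reindex_bij_witness[of _ "\<lambda>n. 2 * n + 1" "\<lambda>n. (n - 1) div 2"])
       (auto simp: field_simps simp flip: power_mult_distrib inverse_mult_distrib elim!: oddE)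
  finally have "(\<lambda>n. inverse ((1 / 2 + of_int n :: complex) ^ Suc j)) summable_on UNIV"
    by (subst (asm) summable_on_cmult_right') auto
  moreover have half: "(1 / 2 :: complex) \<notin> \<int>"
    using fraction_not_in_Ints[where 'a = complex, of 2 1] by simp
  ultimately have "((\<lambda>n :: int. inverse ((1 / 2 + of_int n :: complex) ^ Suc j)) has_sum
      (Polygamma j (1 / 2) + (-1) ^ Suc j * Polygamma j (1 - 1 / 2)) / fact j) (UNIV :: int set)"
    using assms(1) by (rule Polygamma_has_sum_int)
  \<comment> \<open>The cotangent of \<open>pi / 2\<close> is 0, so only the constant coefficient of
    \<open>cot_poly j\<close> remains.\<close>
  also have "(Polygamma j (1 / 2) + (-1) ^ Suc j * Polygamma j (1 - 1 / 2 :: complex)) / fact j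
      = pi ^ Suc j * poly (cot_poly j) 0 / fact j" (is "_ = ?L")
    by (subst Polygamma_reflection_cot[OF half]) (simp add: cot_def cos_of_real_pi_half)
  finally have "((\<lambda>n :: int. inverse (2 ^ Suc j) * inverse ((1 / 2 + of_int n :: complex) ^ Suc j))
      has_sum inverse (2 ^ Suc j) * ?L) (UNIV :: int set)"
    by (rule has_sum_cmult_right)
  also have "?this \<longleftrightarrow> (?f has_sum inverse (2 ^ Suc j) * ?L) {n. odd n}"
    by (rule has_sum_reindex_bij_witness[of _ "\<lambda>n. (n - 1) div 2" "\<lambda>n. 2 * n + 1"])
       (auto simp: field_simps simp flip: power_mult_distrib inverse_mult_distrib elim!: oddE)
  finally have "(?f has_sum (inverse (2 ^ Suc j) * Z + inverse (2 ^ Suc j) * ?L)) ({n. even n \<and> n \<noteq> 0} \<union> {n. odd n})"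
    using even by (intro has_sum_Un_disjoint) auto
  also have "{n. even n \<and> n \<noteq> 0} \<union> {n :: int. odd n} = - {0}" by auto
  \<comment> \<open>The even terms reproduce \<open>Z\<close> up to a power of 2 and the odd terms
    are known, which leaves a linear equation for \<open>Z\<close>.\<close>
  finally have "Z = inverse (2 ^ Suc j) * Z + inverse (2 ^ Suc j) * ?L"
    using Z has_sum_unique by blast
  then have "(2 ^ Suc j - 1) * Z = ?L" by (simp add: field_simps)
  moreover have "(2 ^ Suc j - 1 :: complex) \<noteq> 0"
  proof -
    have "(2 ^ Suc j :: nat) \<noteq> 1" by simp
    then show ?thesis by (metis of_nat_1 of_nat_eq_iff of_nat_numeral of_nat_power right_minus_eq)
  qed
  ultimately have "Z = pi ^ Suc j * poly (cot_poly j) 0 / (fact j * (2 ^ Suc j - 1))"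
    by (simp add: field_simps)
  with Z show ?thesis by simp
qed

section \<open>Divisor sums and the q-expansion of Eisenstein series\<close>

definition divisor_sum :: "nat \<Rightarrow> nat \<Rightarrow> nat" where
  "divisor_sum j n = (if n = 0 then 0 else \<Sum>d | d dvd n. d ^ j)"

lemma lambert_summable:
  fixes q :: complex
  assumes "norm q < 1"
  shows "(\<lambda>(m, n). of_nat n ^ j * q ^ (m * n)) summable_on ({1..} \<times> {1 :: nat..})"
proof -
  define \<rho> where "\<rho> = norm q"
  have \<rho>: "0 \<le> \<rho>" "\<rho> < 1" using assms by (simp_all add: \<rho>_def)
  let ?h = "\<lambda>n. real n ^ j * \<rho> ^ n"
  have *: "(\<lambda>n. real n ^ i * \<rho> ^ n) summable_on A" for A i
  proof -
    have "summable (\<lambda>n. real n ^ i * \<rho> ^ n)"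
      by (rule summable_powser_power) (use \<rho> in auto)
    then have "(\<lambda>n. real n ^ i * \<rho> ^ n) summable_on UNIV"
      by (rule summable_nonneg_imp_summable_on) (use \<rho> in auto)
    then show ?thesis by (rule summable_on_subset) auto
  qed
  have h: "?h summable_on {1..}" by (rule *)
  have pred: "(\<lambda>m. \<rho> ^ (m - 1)) summable_on {1..}"
  proof -
    have "(\<lambda>m. \<rho> ^ m) summable_on UNIV" using *[of 0] by simp
    also have "?this \<longleftrightarrow> ?thesis"
      by (rule summable_on_reindex_bij_witness[of _ "\<lambda>m. m - 1" Suc]) auto
    finally show ?thesis .
  qed
  have "(\<lambda>(m, n). \<rho> ^ (m - 1) * ?h n) summable_on ({1..} \<times> {1..})"
  proof (rule summable_on_SigmaI)
    show "((\<lambda>n. (case (m, n) of (m, n) \<Rightarrow> \<rho> ^ (m - 1) * ?h n)) has_sum \<rho> ^ (m - 1) * infsum ?h {1..}) {1..}" for m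
      unfolding prod.case by (intro has_sum_cmult_right has_sum_infsum h)
    show "(\<lambda>m. \<rho> ^ (m - 1) * infsum ?h {1..}) summable_on {1..}"
      by (intro summable_on_cmult_left pred)
  qed (use \<rho> in auto)
  moreover have "norm (case p of (m, n) \<Rightarrow> of_nat n ^ j * q ^ (m * n)) \<le> (case p of (m, n) \<Rightarrow> \<rho> ^ (m - 1) * ?h n)"
    if "p \<in> {1..} \<times> {1..}" for p
  proof (cases p)
    case (Pair m n)
    have "m \<noteq> 0" "n \<noteq> 0" using that Pair by auto
    then obtain a b where ab: "m = Suc a" "n = Suc b"
      using not0_implies_Suc by blast
    \<comment> \<open>For \<open>m, n \<ge> 1\<close> we have
      \<open>m * n \<ge> (m - 1) + n\<close>, which separates the variables in the majorant.\<close>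
    have "\<rho> ^ (m * n) \<le> \<rho> ^ (m - 1 + n)"
      using \<rho> by (intro power_decreasing) (auto simp: ab)
    then have "real n ^ j * \<rho> ^ (m * n) \<le> real n ^ j * \<rho> ^ (m - 1 + n)"
      by (intro mult_left_mono) auto
    then show ?thesis
      using Pair by (simp add: norm_mult norm_power power_add mult_ac flip: \<rho>_def)
  qed
  ultimately have "(\<lambda>p. norm (case p of (m, n) \<Rightarrow> of_nat n ^ j * q ^ (m * n))) summable_on ({1..} \<times> {1 :: nat..})"
    by (rule Infinite_Sum.abs_summable_on_comparison_test')
  then show ?thesis by (rule abs_summable_summable)
qed

text \<open>The pairs \<open>(m, n)\<close> are grouped by their product \<open>N\<close>; in each
  group \<open>n\<close> runs through the divisors of \<open>N\<close>.\<close>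

lemma lambert_divisor_sum:
  fixes q :: complex
  assumes "norm q < 1"
  shows "(\<lambda>n. of_nat (divisor_sum j n) * q ^ n) sums (\<Sum>\<^sub>\<infinity>(m, n)\<in>{1..} \<times> {1..}. of_nat n ^ j * q ^ (m * n))"
    (is "_ sums ?S")
proof -
  have "((\<lambda>(m, n). of_nat n ^ j * q ^ (m * n)) has_sum ?S) ({1..} \<times> {1..})"
    by (intro has_sum_infsum lambert_summable assms)
  also have "?this \<longleftrightarrow> ((\<lambda>(N, d). of_nat d ^ j * q ^ N) has_sum ?S) (SIGMA N:{1..}. {d. d dvd N})"
    by (rule has_sum_reindex_bij_witness[of _ "\<lambda>(N, d). (N div d, d)" "\<lambda>(m, n). (m * n, n)"])
       (auto elim!: dvdE simp: Suc_le_eq)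
  finally have "((\<lambda>N. \<Sum>d | d dvd N. of_nat d ^ j * q ^ N) has_sum ?S) {1..}"
    by (rule has_sum_SigmaD) (auto intro!: has_sum_finite)
  also have "?this \<longleftrightarrow> ((\<lambda>n. of_nat (divisor_sum j n) * q ^ n) has_sum ?S) UNIV"
    by (rule has_sum_cong_neutral) (auto simp: divisor_sum_def sum_distrib_right)
  finally show ?thesis by (rule has_sum_imp_sums)
qed

text \<open>Row \<open>m > 0\<close> of the lattice is the Lipschitz formula at
  \<open>m * z\<close>, row \<open>- m\<close> has the same sum because the exponent is even, and
  row 0 gives the zeta value. The positive rows together form a Lambert series.\<close>

lemma Eis_q_expansion:
  assumes "Im z > 0" "odd j" "j \<ge> 3"
  shows "(\<lambda>n. 2 * ((2 * pi * \<i>) ^ Suc j / fact j) * (of_nat (divisor_sum j n) * nome z ^ n)) sums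
    (Eis (Suc j) z - pi ^ Suc j * poly (cot_poly j) 0 / (fact j * (2 ^ Suc j - 1)))"
proof -
  let ?f = "\<lambda>m n :: int. inverse ((of_int m * z + of_int n) ^ Suc j)"
  let ?c = "(2 * pi * \<i>) ^ Suc j / fact j :: complex"
  let ?Z = "pi ^ Suc j * poly (cot_poly j) 0 / (fact j * (2 ^ Suc j - 1)) :: complex"
  let ?T = "\<Sum>\<^sub>\<infinity>(m, n)\<in>{1..} \<times> {1 :: nat..}. of_nat n ^ j * nome z ^ (m * n)"
  have q: "norm (nome z) < 1" using assms(1) by (rule norm_nome_less_1)
  have summ: "(\<lambda>(m, n). ?f m n) summable_on A" if "A \<subseteq> lattice" for A
    by (rule summable_on_subset_banach[OF lattice_summable]) (use assms that in auto)
  have row: "infsum (?f (int m)) UNIV = ?c * (\<Sum>\<^sub>\<infinity>n\<in>{1..}. of_nat n ^ j * nome z ^ (m * n))" if "m \<ge> 1" for m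
  proof -
    have m: "Im (of_nat m * z) > 0" using that assms(1) by simp
    have "infsum (?f (int m)) UNIV = ?c * power_lambert j (nome (of_nat m * z))"
      using Lipschitz_formula[OF m assms(2,3)] by (simp add: infsumI)
    also have "power_lambert j (nome (of_nat m * z)) = (\<Sum>\<^sub>\<infinity>n\<in>{1..}. of_nat n ^ j * nome z ^ (m * n))"
    proof -
      have "(\<lambda>n. of_nat n ^ j * nome z ^ (m * n)) summable_on {1..}"
        by (rule summable_on_SigmaD1[OF lambert_summable[OF q]]) (use that in auto)
      then have "((\<lambda>n. of_nat n ^ j * nome z ^ (m * n)) has_sum (\<Sum>\<^sub>\<infinity>n\<in>{1..}. of_nat n ^ j * nome z ^ (m * n))) {1..}"
        by (rule has_sum_infsum)
      also have "?this \<longleftrightarrow> ((\<lambda>n. of_nat n ^ j * nome z ^ (m * n))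
          has_sum (\<Sum>\<^sub>\<infinity>n\<in>{1..}. of_nat n ^ j * nome z ^ (m * n))) UNIV"
        by (rule has_sum_cong_neutral) (use assms in \<open>auto simp: power_0_left\<close>)
      finally have "(\<lambda>n. of_nat n ^ j * nome z ^ (m * n)) sums (\<Sum>\<^sub>\<infinity>n\<in>{1..}. of_nat n ^ j * nome z ^ (m * n))"
        by (rule has_sum_imp_sums)
      moreover have "nome (of_nat m * z) ^ n = nome z ^ (m * n)" for n
        by (simp add: power_mult nome_power)
      ultimately show ?thesis by (simp add: power_lambert_def sums_iff)
    qed
    finally show ?thesis .
  qed
  have pos: "infsum (\<lambda>(m, n). ?f m n) ({1..} \<times> UNIV) = ?c * ?T"
  proof -
    have "infsum (\<lambda>(m, n). ?f m n) ({1..} \<times> UNIV) = (\<Sum>\<^sub>\<infinity>m\<in>{1..}. infsum (?f m) UNIV)"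
      by (rule infsum_Sigma'_banach[symmetric]) (rule summ, auto simp: lattice_def)
    also have "\<dots> = (\<Sum>\<^sub>\<infinity>m\<in>{1..}. infsum (?f (int m)) UNIV)"
      by (rule infsum_reindex_bij_witness[of _ int nat]) auto
    also have "\<dots> = (\<Sum>\<^sub>\<infinity>m\<in>{1..}. ?c * (\<Sum>\<^sub>\<infinity>n\<in>{1..}. of_nat n ^ j * nome z ^ (m * n)))"
      by (intro infsum_cong row) auto
    also have "\<dots> = ?c * (\<Sum>\<^sub>\<infinity>m\<in>{1..}. \<Sum>\<^sub>\<infinity>n\<in>{1..}. of_nat n ^ j * nome z ^ (m * n))"
      by (rule infsum_cmult_right')
    also have "(\<Sum>\<^sub>\<infinity>m\<in>{1..}. \<Sum>\<^sub>\<infinity>n\<in>{1..}. of_nat n ^ j * nome z ^ (m * n)) = ?T"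
      by (rule infsum_Sigma'_banach[OF lambert_summable[OF q]])
    finally show ?thesis .
  qed
  have neg: "infsum (\<lambda>(m, n). ?f m n) ({..-1} \<times> UNIV) = ?c * ?T"
  proof -
    have ev: "?f (- m) (- n) = ?f m n" for m n
    proof -
      have "of_int (- m) * z + of_int (- n) = - (of_int m * z + of_int n)" by simp
      then show ?thesis using assms(2) by (metis even_Suc power_minus_even)
    qed
    have "infsum (\<lambda>(m, n). ?f m n) ({..-1} \<times> UNIV) = infsum (\<lambda>(m, n). ?f m n) ({1..} \<times> UNIV)"
      by (rule infsum_reindex_bij_witness[of _ "\<lambda>(m, n). (- m, - n)" "\<lambda>(m, n). (- m, - n)"])
         (use ev in auto)
    with pos show ?thesis by simp
  qed
  have zero: "infsum (\<lambda>(m, n). ?f m n) ({0} \<times> - {0}) = ?Z"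
  proof -
    have "infsum (\<lambda>(m, n). ?f m n) ({0} \<times> - {0}) = infsum (\<lambda>n. inverse (of_int n ^ Suc j)) (- {0 :: int})"
      by (rule infsum_reindex_bij_witness[of _ "\<lambda>n. (0, n)" snd]) auto
    then show ?thesis using zeta_has_sum[OF assms(2,3)] by (simp add: infsumI)
  qed
  have "lattice = {0} \<times> - {0} \<union> ({1..} \<times> UNIV \<union> {..-1} \<times> UNIV)"
    by (auto simp: lattice_def)
  then have "Eis (Suc j) z = infsum (\<lambda>(m, n). ?f m n) ({0} \<times> - {0} \<union> ({1..} \<times> UNIV \<union> {..-1} \<times> UNIV))"
    by (simp only: Eis_def)
  also have "\<dots> = ?Z + (?c * ?T + ?c * ?T)"
    by (subst infsum_Un_disjoint, (rule summ, force simp: lattice_def)+, force,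
        subst infsum_Un_disjoint, (rule summ, force simp: lattice_def)+, force)
       (simp only: pos neg zero)
  finally have "Eis (Suc j) z - ?Z = 2 * ?c * ?T" by simp
  then show ?thesis
    using sums_mult[OF lambert_divisor_sum[OF q], of "2 * ?c"] by simp
qed

section \<open>The discriminant\<close>

text \<open>The target ring is left open: complex numbers for evaluation, \<open>bit\<close> for
  reduction modulo 2.\<close>

definition fps_of_int_coeffs :: "int fps \<Rightarrow> 'a :: comm_ring_1 fps" where
  "fps_of_int_coeffs f = Abs_fps (\<lambda>n. of_int (fps_nth f n))"

lemma fps_of_int_coeffs_nth [simp]: "fps_nth (fps_of_int_coeffs f) n = of_int (fps_nth f n)"
  by (simp add: fps_of_int_coeffs_def)

lemma fps_of_int_coeffs_hom:
  "fps_of_int_coeffs (f + g) = fps_of_int_coeffs f + fps_of_int_coeffs g"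
  "fps_of_int_coeffs (f - g) = fps_of_int_coeffs f - fps_of_int_coeffs g"
  "fps_of_int_coeffs (f * g) = fps_of_int_coeffs f * fps_of_int_coeffs g"
  "fps_of_int_coeffs (fps_const c) = fps_const (of_int c)"
  "fps_of_int_coeffs 1 = 1"
  by (auto intro!: fps_ext simp: fps_mult_nth)

lemma fps_of_int_coeffs_power:
  "fps_of_int_coeffs (f ^ n) = fps_of_int_coeffs f ^ n"
  by (induction n) (simp_all add: fps_of_int_coeffs_hom)

lemma fps_of_int_coeffs_numeral: "fps_of_int_coeffs (numeral c) = numeral c"
  unfolding numeral_fps_const by (simp add: fps_of_int_coeffs_hom)

definition sigma_fps :: "nat \<Rightarrow> int fps" where
  "sigma_fps j = Abs_fps (\<lambda>n. int (divisor_sum j n))"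

text \<open>Checked modulo 3 and modulo 8. The one congruence yields both divisibility by 12, hence
  integrality of the discriminant, and the parity of the quotient, hence its reduction modulo
  2.\<close>

lemma mod_24_quintic:
  fixes d :: nat
  shows "(5 * d ^ 3 + 7 * d ^ 5) mod 24 = (if odd d then 12 else 0)"
proof -
  let ?p = "\<lambda>d :: nat. 5 * d ^ 3 + 7 * d ^ 5"
  have p: "[?p d = ?p (d mod m)] (mod m)" for m
    by (intro cong_add cong_mult cong_pow cong_refl) (simp_all add: cong_def)
  have "d mod 3 = 0 \<or> d mod 3 = 1 \<or> d mod 3 = 2" by presburger
  then have "?p (d mod 3) mod 3 = 0" by (elim disjE) (simp_all only:, simp_all)
  then have 3: "?p d mod 3 = 0" using p[of 3] by (simp only: cong_def)
  have *: "?p (d mod 8) mod 8 = 0" if "even d"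
  proof -
    have "d mod 8 = 0 \<or> d mod 8 = 2 \<or> d mod 8 = 4 \<or> d mod 8 = 6" using that by presburger
    then show ?thesis by (elim disjE) (simp_all only:, simp_all)
  qed
  have even: "?p d mod 8 = 0" if "even d"
    using p[of 8, unfolded cong_def] *[OF that] by (rule trans)
  have **: "?p (d mod 8) mod 8 = 4" if "odd d"
  proof -
    have "d mod 8 = 1 \<or> d mod 8 = 3 \<or> d mod 8 = 5 \<or> d mod 8 = 7" using that by presburger
    then show ?thesis by (elim disjE) (simp_all only:, simp_all)
  qed
  have odd: "?p d mod 8 = 4" if "odd d"
    using p[of 8, unfolded cong_def] **[OF that] by (rule trans)
  have "x mod 24 = (if b then 12 else 0)" if "x mod 3 = 0" "x mod 8 = (if b then 4 else 0)" for x :: nat and b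
    using that by (cases b; simp; presburger)
  from this[OF 3] show ?thesis using even odd by simp
qed

definition Delta_linear :: "int fps" where
  "Delta_linear = Abs_fps (\<lambda>n. if n = 0 then 0 else \<Sum>d | d dvd n. int ((5 * d ^ 3 + 7 * d ^ 5) div 12))"

lemma Delta_linear: "12 * Delta_linear = 5 * sigma_fps 3 + 7 * sigma_fps 5"
proof (rule fps_ext)
  fix n
  have *: "12 * int ((5 * d ^ 3 + 7 * d ^ 5) div 12) = int (5 * d ^ 3 + 7 * d ^ 5)" for d :: nat
  proof -
    have "12 * (x div 12) = x" if "x mod 24 = (if odd d then 12 else 0)" for x :: nat
      using that by (simp split: if_splits; presburger)
    then show ?thesis using mod_24_quintic by (metis of_nat_mult of_nat_numeral)
  qed
  show "fps_nth (12 * Delta_linear) n = fps_nth (5 * sigma_fps 3 + 7 * sigma_fps 5) n"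
  proof (cases "n = 0")
    case False
    then have "fps_nth (12 * Delta_linear) n = (\<Sum>d | d dvd n. int (5 * d ^ 3 + 7 * d ^ 5))"
      by (simp only: fps_mult_numeral_left Delta_linear_def fps_nth_Abs_fps if_False sum_distrib_left *)
    then show ?thesis
      using False by (simp add: sigma_fps_def divisor_sum_def sum_distrib_left sum.distrib)
  qed (simp add: Delta_linear_def sigma_fps_def divisor_sum_def)
qed

text \<open>The expansion of \<open>((1 + 240 S\<^sub>3)\<^sup>3 - (1 - 504 S\<^sub>5)\<^sup>2) / 1728\<close>, whose linear part is \<open>(5 S\<^sub>3 + 7 S\<^sub>5) / 12\<close>.\<close>

definition Delta_fps :: "int fps" where
  "Delta_fps = Delta_linear + 100 * sigma_fps 3 ^ 2 + 8000 * sigma_fps 3 ^ 3 - 147 * sigma_fps 5 ^ 2"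

lemma Delta_fps: "1728 * Delta_fps = (1 + 240 * sigma_fps 3) ^ 3 - (1 - 504 * sigma_fps 5) ^ 2"
proof -
  have "1728 * Delta_fps = 144 * (12 * Delta_linear)
      + 1728 * (100 * sigma_fps 3 ^ 2 + 8000 * sigma_fps 3 ^ 3 - 147 * sigma_fps 5 ^ 2)"
    unfolding Delta_fps_def by algebra
  then show ?thesis unfolding Delta_linear by algebra
qed

lemma nome_surj:
  assumes "norm q < 1" "q \<noteq> 0"
  obtains z where "Im z > 0" "nome z = q"
proof
  let ?z = "Ln q / (2 * pi * \<i>)"
  have "?z = - \<i> * Ln q / (2 * pi)" by (simp add: field_simps)
  then have "Im ?z = - Re (Ln q) / (2 * pi)" by simp
  then show "Im ?z > 0" using assms by (simp add: Re_Ln divide_neg_pos)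
  show "nome ?z = q" using assms(2) by (simp add: nome_def)
qed

text \<open>Every \<open>q\<close> with \<open>0 < norm q < 1\<close> is a nome, so convergence at
  all nomes covers the punctured unit disc.\<close>

lemma fps_conv_radius_ge_1:
  fixes f :: "complex fps"
  assumes "\<And>z. Im z > 0 \<Longrightarrow> summable (\<lambda>n. fps_nth f n * nome z ^ n)"
  shows "fps_conv_radius f \<ge> 1"
  unfolding fps_conv_radius_def
proof (rule conv_radius_geI_ex)
  fix x :: real assume "0 < x" "ereal x < 1"
  then have "norm (of_real x :: complex) < 1" "(of_real x :: complex) \<noteq> 0" by auto
  then obtain z where "Im z > 0" "nome z = of_real x" by (rule nome_surj)
  with assms[of z] \<open>0 < x\<close> show "\<exists>z. norm z = x \<and> summable (\<lambda>n. fps_nth f n * z ^ n)"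
    by (intro exI[of _ "of_real x"]) auto
qed

lemma sigma_sums:
  assumes "Im z > 0"
  shows "summable (\<lambda>n. fps_nth (fps_of_int_coeffs (sigma_fps j)) n * nome z ^ n)"
  using lambert_divisor_sum[OF norm_nome_less_1[OF assms], of j]
  by (simp add: sigma_fps_def sums_iff)

lemma conv_radius_sigma: "fps_conv_radius (fps_of_int_coeffs (sigma_fps j) :: complex fps) \<ge> 1"
  by (rule fps_conv_radius_ge_1) (rule sigma_sums)

lemma eval_sigma:
  assumes "Im z > 0"
  shows "(\<lambda>n. of_nat (divisor_sum j n) * nome z ^ n) sums eval_fps (fps_of_int_coeffs (sigma_fps j)) (nome z)"
  using sigma_sums[OF assms, of j] unfolding eval_fps_def by (simp add: sigma_fps_def sums_iff)

text \<open>The constant term is \<open>2 * zeta(4) = pi ^ 4 / 45\<close>, found from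
  \<open>cot_poly 3\<close>; \<open>Eis_6\<close> has \<open>2 * zeta(6) = 2 * pi ^ 6 / 945\<close>
  in its place.\<close>

lemma Eis_4:
  assumes "Im z > 0"
  shows "Eis 4 z = pi ^ 4 / 45 * (1 + 240 * eval_fps (fps_of_int_coeffs (sigma_fps 3)) (nome z))"
proof -
  have *: "(2 * pi * \<i>) ^ 4 = (16 * pi ^ 4 :: complex)" by (simp add: power_mult_distrib)
  have "Eis (Suc 3) z - pi ^ Suc 3 * poly (cot_poly 3) 0 / (fact 3 * (2 ^ Suc 3 - 1))
     = 2 * ((2 * pi * \<i>) ^ Suc 3 / fact 3) * eval_fps (fps_of_int_coeffs (sigma_fps 3)) (nome z)"
    by (rule sums_unique2[OF Eis_q_expansion sums_mult[OF eval_sigma]]) (use assms in auto)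
  moreover have "poly (cot_poly 3) 0 = 2"
    by (simp add: numeral_3_eq_3 pderiv_pCons)
  ultimately have "3 * Eis 4 z = 3 * (pi ^ 4 / 45 * (1 + 240 * eval_fps (fps_of_int_coeffs (sigma_fps 3)) (nome z)))"
    using *
    by (simp add: fact_numeral field_simps)
  then show ?thesis by (subst (asm) mult_left_cancel) simp
qed

lemma Eis_6:
  assumes "Im z > 0"
  shows "Eis 6 z = 2 * pi ^ 6 / 945 * (1 - 504 * eval_fps (fps_of_int_coeffs (sigma_fps 5)) (nome z))"
proof -
  have *: "(2 * pi * \<i>) ^ 6 = (- 64 * pi ^ 6 :: complex)" by (simp add: power_mult_distrib)
  have "Eis (Suc 5) z - pi ^ Suc 5 * poly (cot_poly 5) 0 / (fact 5 * (2 ^ Suc 5 - 1))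
     = 2 * ((2 * pi * \<i>) ^ Suc 5 / fact 5) * eval_fps (fps_of_int_coeffs (sigma_fps 5)) (nome z)"
    by (rule sums_unique2[OF Eis_q_expansion sums_mult[OF eval_sigma]]) (use assms in auto)
  moreover have "poly (cot_poly 5) 0 = 16"
    by (simp add: eval_nat_numeral pderiv_pCons)
  ultimately show ?thesis using *
    by (simp add: fact_numeral field_simps)
qed

text \<open>Defined by its integral q-series, which gives holomorphy and boundedness directly;
  modularity is transferred from the Eisenstein series by \<open>Delta_eq_Eis\<close>.\<close>

definition Delta :: "complex \<Rightarrow> complex" where
  "Delta z = eval_fps (fps_of_int_coeffs Delta_fps) (nome z)"

lemma Delta_fps_complex:
  "fps_of_int_coeffs Delta_fps = fps_const (1 / 1728 :: complex) *
     ((1 + 240 * fps_of_int_coeffs (sigma_fps 3)) ^ 3 - (1 - 504 * fps_of_int_coeffs (sigma_fps 5)) ^ 2)"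
proof -
  have "fps_of_int_coeffs (1728 * Delta_fps) =
     ((1 + 240 * fps_of_int_coeffs (sigma_fps 3)) ^ 3
      - (1 - 504 * fps_of_int_coeffs (sigma_fps 5)) ^ 2 :: complex fps)"
    unfolding Delta_fps by (simp only: fps_of_int_coeffs_hom fps_of_int_coeffs_power fps_of_int_coeffs_numeral)
  moreover have "fps_of_int_coeffs Delta_fps = fps_const (1 / 1728 :: complex) * fps_of_int_coeffs (1728 * Delta_fps)"
    by (rule fps_ext) simp
  ultimately show ?thesis by simp
qed

lemma conv_radius_E4: "fps_conv_radius (1 + 240 * fps_of_int_coeffs (sigma_fps 3) :: complex fps) \<ge> 1"
  by (rule order.trans[OF _ fps_conv_radius_add])
     (use conv_radius_sigma[of 3] in \<open>auto intro!: order.trans[OF _ fps_conv_radius_mult]\<close>)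

lemma conv_radius_E6: "fps_conv_radius (1 - 504 * fps_of_int_coeffs (sigma_fps 5) :: complex fps) \<ge> 1"
  by (rule order.trans[OF _ fps_conv_radius_diff])
     (use conv_radius_sigma[of 5] in \<open>auto intro!: order.trans[OF _ fps_conv_radius_mult]\<close>)

lemma conv_radius_E:
  "fps_conv_radius ((1 + 240 * fps_of_int_coeffs (sigma_fps 3)) ^ 3 :: complex fps) \<ge> 1"
  "fps_conv_radius ((1 - 504 * fps_of_int_coeffs (sigma_fps 5)) ^ 2 :: complex fps) \<ge> 1"
  "fps_conv_radius ((1 + 240 * fps_of_int_coeffs (sigma_fps 3)) ^ 3
      - (1 - 504 * fps_of_int_coeffs (sigma_fps 5)) ^ 2 :: complex fps) \<ge> 1"
proof -
  show 1: "fps_conv_radius ((1 + 240 * fps_of_int_coeffs (sigma_fps 3)) ^ 3 :: complex fps) \<ge> 1"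
    using conv_radius_E4 fps_conv_radius_power order.trans by blast
  show 2: "fps_conv_radius ((1 - 504 * fps_of_int_coeffs (sigma_fps 5)) ^ 2 :: complex fps) \<ge> 1"
    using conv_radius_E6 fps_conv_radius_power order.trans by blast
  show "fps_conv_radius ((1 + 240 * fps_of_int_coeffs (sigma_fps 3)) ^ 3
      - (1 - 504 * fps_of_int_coeffs (sigma_fps 5)) ^ 2 :: complex fps) \<ge> 1"
    by (rule order.trans[OF _ fps_conv_radius_diff]) (use 1 2 in auto)
qed

lemma conv_radius_Delta: "fps_conv_radius (fps_of_int_coeffs Delta_fps :: complex fps) \<ge> 1"
  unfolding Delta_fps_complex by (rule order.trans[OF _ fps_conv_radius_mult]) (use conv_radius_E in auto)

lemma Delta_eq_Eis:
  assumes "Im z > 0"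
  shows "1728 * Delta z = (45 / pi ^ 4 * Eis 4 z) ^ 3 - (945 / (2 * pi ^ 6) * Eis 6 z) ^ 2"
proof -
  let ?e4 = "1 + 240 * fps_of_int_coeffs (sigma_fps 3) :: complex fps"
  let ?e6 = "1 - 504 * fps_of_int_coeffs (sigma_fps 5) :: complex fps"
  have q: "ereal (norm (nome z)) < 1" using norm_nome_less_1[OF assms] by simp
  have lt: "ereal (norm (nome z)) < fps_conv_radius f" if "fps_conv_radius f \<ge> 1" for f :: "complex fps"
    using q that by (rule less_le_trans)
  have "Delta z = (eval_fps ?e4 (nome z) ^ 3 - eval_fps ?e6 (nome z) ^ 2) / 1728"
    unfolding Delta_def Delta_fps_complex
    by (simp add: eval_fps_mult eval_fps_diff eval_fps_power lt conv_radius_E conv_radius_E4 conv_radius_E6)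
  moreover have "eval_fps ?e4 (nome z) = 1 + 240 * eval_fps (fps_of_int_coeffs (sigma_fps 3)) (nome z)"
    using order.trans[OF _ fps_conv_radius_mult, of 1 240 "fps_of_int_coeffs (sigma_fps 3) :: complex fps"]
    by (subst eval_fps_add) (auto simp: eval_fps_mult lt conv_radius_sigma)
  moreover have "eval_fps ?e6 (nome z) = 1 - 504 * eval_fps (fps_of_int_coeffs (sigma_fps 5)) (nome z)"
    using order.trans[OF _ fps_conv_radius_mult, of 1 504 "fps_of_int_coeffs (sigma_fps 5) :: complex fps"]
    by (subst eval_fps_diff) (auto simp: eval_fps_mult lt conv_radius_sigma)
  moreover have "45 / pi ^ 4 * (pi ^ 4 / 45 * x) = x" "945 / (2 * pi ^ 6) * (2 * pi ^ 6 / 945 * x) = x" for x :: complex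
    by simp_all
  ultimately show ?thesis
    unfolding Eis_4[OF assms] Eis_6[OF assms] by (simp only:) simp
qed

section \<open>Modularity and behaviour at the cusps\<close>

lemma Im_moebius:
  fixes a b c d :: int
  assumes "a * d - b * c = 1"
  shows "Im ((of_int a * z + of_int b) / (of_int c * z + of_int d)) = Im z / norm (of_int c * z + of_int d) ^ 2"
proof -
  have "Im ((of_int a * z + of_int b) / (of_int c * z + of_int d))
      = Im z * of_int (a * d - b * c) / norm (of_int c * z + of_int d) ^ 2"
    by (simp add: Im_divide cmod_power2 algebra_simps diff_divide_distrib)
  then show ?thesis using assms by simp
qed

lemma moebius_denominator_nonzero:
  fixes a b c d :: int
  assumes "a * d - b * c = 1" "Im z > 0"
  shows "of_int c * z + of_int d \<noteq> 0"
proof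
  assume *: "of_int c * z + of_int d = 0"
  then have "Im (of_int c * z + of_int d) = 0" "Re (of_int c * z + of_int d) = 0"
    by (simp_all only: zero_complex.simps)
  with assms have "c = 0" "d = 0" by auto
  with assms(1) show False by simp
qed

lemma Im_moebius_pos:
  fixes a b c d :: int
  assumes "a * d - b * c = 1" "Im z > 0"
  shows "Im ((of_int a * z + of_int b) / (of_int c * z + of_int d)) > 0"
  using assms moebius_denominator_nonzero[OF assms] by (simp add: Im_moebius)

lemma Delta_modular:
  fixes a b c d :: int
  assumes "a * d - b * c = 1" "Im z > 0"
  shows "Delta ((of_int a * z + of_int b) / (of_int c * z + of_int d)) = (of_int c * z + of_int d) ^ 12 * Delta z"
proof -
  let ?j = "of_int c * z + of_int d"
  have "1728 * Delta ((of_int a * z + of_int b) / ?j)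
      = (45 / pi ^ 4 * (?j ^ 4 * Eis 4 z)) ^ 3 - (945 / (2 * pi ^ 6) * (?j ^ 6 * Eis 6 z)) ^ 2"
    by (simp only: Delta_eq_Eis[OF Im_moebius_pos[OF assms]] Eis_modular[OF assms])
  also have "\<dots> = ?j ^ 12 * ((45 / pi ^ 4 * Eis 4 z) ^ 3 - (945 / (2 * pi ^ 6) * Eis 6 z) ^ 2)"
    by algebra
  also have "\<dots> = 1728 * (?j ^ 12 * Delta z)"
    by (simp only: Delta_eq_Eis[OF assms(2), symmetric]) simp
  finally show ?thesis by simp
qed

lemma Delta_sums:
  assumes "Im z > 0"
  shows "(\<lambda>n. of_int (fps_nth Delta_fps n) * nome z ^ n) sums Delta z"
proof -
  have "ereal (norm (nome z)) < 1" using norm_nome_less_1[OF assms] by simp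
  then have "ereal (norm (nome z)) < fps_conv_radius (fps_of_int_coeffs Delta_fps :: complex fps)"
    using conv_radius_Delta by (rule less_le_trans)
  from sums_eval_fps[OF this] show ?thesis by (simp add: Delta_def)
qed

lemma Delta_holomorphic: "Delta holomorphic_on {z. Im z > 0}"
proof -
  have "(eval_fps (fps_of_int_coeffs Delta_fps) \<circ> nome) holomorphic_on {z. Im z > 0}"
  proof (rule holomorphic_on_compose)
    show "nome holomorphic_on {z. Im z > 0}"
      unfolding nome_def by (intro holomorphic_intros)
    show "eval_fps (fps_of_int_coeffs Delta_fps) holomorphic_on nome ` {z. Im z > 0}"
    proof (intro holomorphic_on_eval_fps, clarify)
      fix z assume "Im z > 0"
      then have "ereal (norm (nome z)) < 1" using norm_nome_less_1 by simp
      also note conv_radius_Delta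
      finally show "nome z \<in> eball 0 (fps_conv_radius (fps_of_int_coeffs Delta_fps :: complex fps))" by simp
    qed
  qed
  then show ?thesis by (simp add: o_def Delta_def[abs_def])
qed

text \<open>The nome maps the half plane \<open>Im z \<ge> \<epsilon>\<close> into a closed disc of
  radius less than 1, which is compact inside the disc of convergence.\<close>

lemma Delta_bounded:
  assumes "\<epsilon> > 0"
  obtains K where "K > 0" "\<And>z. Im z \<ge> \<epsilon> \<Longrightarrow> norm (Delta z) \<le> K"
proof -
  let ?D = "cball (0 :: complex) (exp (- 2 * pi * \<epsilon>))"
  have "ereal (exp (- 2 * pi * \<epsilon>)) < 1" using assms by simp
  then have less: "ereal (exp (- 2 * pi * \<epsilon>)) < fps_conv_radius (fps_of_int_coeffs Delta_fps :: complex fps)"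
    using conv_radius_Delta by (rule less_le_trans)
  have "?D \<subseteq> eball 0 (fps_conv_radius (fps_of_int_coeffs Delta_fps :: complex fps))"
  proof
    fix q assume "q \<in> ?D"
    then have "ereal (norm q) \<le> ereal (exp (- 2 * pi * \<epsilon>))" by simp
    also note less
    finally show "q \<in> eball 0 (fps_conv_radius (fps_of_int_coeffs Delta_fps :: complex fps))" by simp
  qed
  then have "continuous_on ?D (eval_fps (fps_of_int_coeffs Delta_fps))"
    by (rule continuous_on_subset[OF continuous_on_eval_fps])
  then have "bounded (eval_fps (fps_of_int_coeffs Delta_fps) ` ?D)"
    by (intro compact_imp_bounded compact_continuous_image) auto
  then obtain K where "K > 0" "\<And>q. q \<in> ?D \<Longrightarrow> norm (eval_fps (fps_of_int_coeffs Delta_fps) q) \<le> K"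
    unfolding bounded_pos by auto
  then show thesis
    by (intro that[of K]) (auto simp: Delta_def norm_nome)
qed

text \<open>\<open>Delta\<close> is modular for the full group, so at each cusp the slashed function
  is \<open>Delta\<close> itself.\<close>

lemma modular_form_Delta: "modular_form_Gamma0 5 12 Delta"
  unfolding modular_form_Gamma0_def
proof (intro conjI allI impI ballI)
  show "Delta holomorphic_on upper_half_plane"
    using Delta_holomorphic by (simp add: upper_half_plane_def)
next
  fix a b c d :: int assume "a * d - b * c = 1"
  moreover obtain K where "\<And>z. Im z \<ge> 1 \<Longrightarrow> norm (Delta z) \<le> K"
    using Delta_bounded[of 1] by auto
  ultimately have "norm (Delta ((of_int a * z + of_int b) / (of_int c * z + of_int d)))
      \<le> K * norm (of_int c * z + of_int d) ^ 12" if "Im z \<ge> 1" for z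
    using that by (simp add: Delta_modular norm_mult norm_power mult.commute[of "_ ^ 12"] mult_right_mono)
  then show "\<exists>K. \<forall>z. Im z \<ge> 1 \<longrightarrow>
      norm (Delta ((of_int a * z + of_int b) / (of_int c * z + of_int d))) \<le> K * norm (of_int c * z + of_int d) ^ 12"
    by blast
qed (auto simp: upper_half_plane_def Delta_modular)

text \<open>Column reduction of the matrix with rows \<open>(5 * a, 5 * b)\<close> and
  \<open>(c, d)\<close>. If 5 divides \<open>c\<close>, the right factor is
  \<open>diag(5, 1)\<close>. Otherwise \<open>A = 1\<close>, \<open>D = 5\<close>, and
  \<open>B = u * d\<close> with \<open>u\<close> inverse to \<open>c\<close> modulo 5 makes
  \<open>d - c * B\<close> divisible by 5.\<close>

lemma factor_through_SL2:
  fixes a b c d :: int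
  assumes "a * d - b * c = 1"
  obtains \<alpha> \<beta> \<gamma> \<delta> A B D :: int where
    "\<alpha> * \<delta> - \<beta> * \<gamma> = 1" "A > 0" "D > 0" "A * D = 5"
    "\<alpha> * A = 5 * a" "\<alpha> * B + \<beta> * D = 5 * b" "\<gamma> * A = c" "\<gamma> * B + \<delta> * D = d"
proof (cases "5 dvd c")
  case True
  then obtain \<gamma> where "c = 5 * \<gamma>" ..
  with assms show ?thesis
    by (intro that[of a d "5 * b" \<gamma> 5 1 0]) (auto simp: algebra_simps)
next
  case False
  then have "coprime c 5" using prime_imp_coprime[of "5 :: int" c] by (simp add: coprime_commute)
  then obtain u where "[c * u = 1] (mod 5)" using cong_solve_coprime_int by blast
  then have "5 dvd (1 - c * u) * d"
    by (intro dvd_mult2) (simp add: cong_iff_dvd_diff dvd_diff_commute)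
  then have "5 dvd d - c * (u * d)" by (simp add: algebra_simps)
  then obtain \<delta> where \<delta>: "d - c * (u * d) = 5 * \<delta>" ..
  have "(5 * a) * \<delta> - (b - a * (u * d)) * c = a * (5 * \<delta> + c * (u * d)) - b * c" by algebra
  also have "\<dots> = 1" using assms unfolding \<delta>[symmetric] by simp
  finally show ?thesis
    using \<delta> by (intro that[of "5 * a" \<delta> "b - a * (u * d)" c 1 5 "u * d"]) (simp_all add: algebra_simps)
qed

text \<open>Writing \<open>diag(5, 1) * \<gamma> = \<gamma>' * [[A, B], [0, D]]\<close> reduces the slash of \<open>Delta (5 * z)\<close>
  to the behaviour of \<open>Delta\<close> at the point \<open>(A * z + B) / D\<close>, whose height is at least \<open>1 / 5\<close>.\<close>

lemma modular_form_Delta_5: "modular_form_Gamma0 5 12 (\<lambda>z. Delta (5 * z))"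
  unfolding modular_form_Gamma0_def
proof (intro conjI allI impI ballI)
  have "(Delta \<circ> (\<lambda>z. 5 * z)) holomorphic_on upper_half_plane"
    by (rule holomorphic_on_compose_gen[OF _ Delta_holomorphic])
       (auto intro!: holomorphic_intros simp: upper_half_plane_def)
  then show "(\<lambda>z. Delta (5 * z)) holomorphic_on upper_half_plane"
    by (simp add: o_def)
next
  fix a b c d :: int and z assume *: "a * d - b * c = 1 \<and> 5 dvd c" "z \<in> upper_half_plane"
  then obtain \<gamma> where c: "c = 5 * \<gamma>" by auto
  have "5 * ((of_int a * z + of_int b) / (of_int c * z + of_int d))
      = (of_int a * (5 * z) + of_int (5 * b)) / (of_int \<gamma> * (5 * z) + of_int d)"
    by (simp add: c algebra_simps)
  moreover have "a * d - 5 * b * \<gamma> = 1" "Im (5 * z) > 0"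
    using * c by (simp_all add: upper_half_plane_def)
  ultimately show "Delta (5 * ((of_int a * z + of_int b) / (of_int c * z + of_int d)))
      = (of_int c * z + of_int d) ^ 12 * Delta (5 * z)"
    by (simp only: Delta_modular) (simp add: c algebra_simps)
next
  fix a b c d :: int assume "a * d - b * c = 1"
  then obtain \<alpha> \<beta> \<gamma> \<delta> A B D :: int where
    det: "\<alpha> * \<delta> - \<beta> * \<gamma> = 1" and AD: "A > 0" "D > 0" "A * D = 5" and
    eqs: "\<alpha> * A = 5 * a" "\<alpha> * B + \<beta> * D = 5 * b" "\<gamma> * A = c" "\<gamma> * B + \<delta> * D = d"
    by (rule factor_through_SL2)
  obtain K where K: "K > 0" "\<And>z. Im z \<ge> 1 / 5 \<Longrightarrow> norm (Delta z) \<le> K"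
    using Delta_bounded[of "1 / 5"] by auto
  have "norm (Delta (5 * ((of_int a * z + of_int b) / (of_int c * z + of_int d))))
      \<le> K * norm (of_int c * z + of_int d) ^ 12" if z: "Im z \<ge> 1" for z
  proof -
    define w where "w = (of_int A * z + of_int B) / of_int D"
    have D: "of_int D \<noteq> (0 :: complex)" using AD by simp
    have A1: "A \<ge> 1" using AD by simp
    have "D \<le> A * D" using mult_right_mono[OF A1, of D] AD by simp
    then have D5: "D \<le> 5" using AD by simp
    have "Im w = of_int A * Im z / of_int D"
      by (simp add: w_def)
    moreover have "of_int A * Im z \<ge> 1 * 1"
      using A1 z by (intro mult_mono) auto
    ultimately have "Im w \<ge> 1 / of_int D"
      using AD by (simp add: divide_right_mono)
    moreover have "1 / of_int D \<ge> (1 / 5 :: real)"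
      using AD D5 by (intro divide_left_mono) auto
    ultimately have w: "Im w \<ge> 1 / 5" by linarith
    have e: "of_int (5 * a) = (of_int \<alpha> * of_int A :: complex)"
      "of_int (5 * b) = (of_int \<alpha> * of_int B + of_int \<beta> * of_int D :: complex)"
      "of_int c = (of_int \<gamma> * of_int A :: complex)" "of_int d = (of_int \<gamma> * of_int B + of_int \<delta> * of_int D :: complex)"
      unfolding eqs[symmetric] by simp_all
    have num: "of_int \<alpha> * w + of_int \<beta> = (of_int (5 * a) * z + of_int (5 * b)) / of_int D"
      unfolding e w_def using D by (simp add: field_simps)
    have den: "of_int \<gamma> * w + of_int \<delta> = (of_int c * z + of_int d) / of_int D"
      unfolding e w_def using D by (simp add: field_simps)
    have "5 * ((of_int a * z + of_int b) / (of_int c * z + of_int d))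
        = (of_int \<alpha> * w + of_int \<beta>) / (of_int \<gamma> * w + of_int \<delta>)"
      unfolding num den using D by simp
    also have "Delta \<dots> = (of_int \<gamma> * w + of_int \<delta>) ^ 12 * Delta w"
      using w by (intro Delta_modular det) auto
    finally have "norm (Delta (5 * ((of_int a * z + of_int b) / (of_int c * z + of_int d))))
        = norm (of_int \<gamma> * w + of_int \<delta>) ^ 12 * norm (Delta w)"
      by (simp add: norm_mult norm_power)
    \<comment> \<open>The factor of automorphy at \<open>w\<close> is
      \<open>(c * z + d) / D\<close>, and \<open>D \<ge> 1\<close>.\<close>
    also have "\<dots> \<le> norm (of_int c * z + of_int d) ^ 12 * K"
    proof (intro mult_mono power_mono K w)
      have "norm (of_int c * z + of_int d) / of_int D \<le> norm (of_int c * z + of_int d) / 1"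
        using AD by (intro divide_left_mono) auto
      then show "norm (of_int \<gamma> * w + of_int \<delta>) \<le> norm (of_int c * z + of_int d)"
        unfolding den using AD by (simp add: norm_divide)
    qed auto
    finally show ?thesis by (simp add: mult.commute)
  qed
  then show "\<exists>K. \<forall>z. Im z \<ge> 1 \<longrightarrow>
      norm (Delta (5 * ((of_int a * z + of_int b) / (of_int c * z + of_int d))))
        \<le> K * norm (of_int c * z + of_int d) ^ 12"
    by blast
qed

section \<open>Reduction of the discriminant modulo 2\<close>

lemma bit_fps_numeral [simp]:
  "(numeral (Num.Bit0 n) :: bit fps) = 0"
  "(numeral (Num.Bit1 n) :: bit fps) = 1"
  by (simp_all add: numeral_fps_const)

definition odd_divisors_fps :: "bit fps" where
  "odd_divisors_fps = Abs_fps (\<lambda>n. if n = 0 then 0 else of_nat (card {d. d dvd n \<and> odd d}))"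

lemma of_nat_bit_eq: "(of_nat n :: bit) = of_bool (odd n)"
  by (induction n) auto

lemma of_nat_sum_odd:
  assumes "finite S" "\<And>d. d \<in> S \<Longrightarrow> odd (h d) \<longleftrightarrow> odd d"
  shows "(of_nat (\<Sum>d\<in>S. h d) :: bit) = of_nat (card {d \<in> S. odd (d :: nat)})"
proof -
  have "(of_nat (\<Sum>d\<in>S. h d) :: bit) = (\<Sum>d\<in>S. of_bool (odd d))"
    unfolding of_nat_sum by (intro sum.cong refl) (simp add: of_nat_bit_eq assms(2))
  also have "\<dots> = of_nat (card {d \<in> S. odd d})"
    using assms(1) by (simp add: Int_def)
  finally show ?thesis .
qed

lemma sigma_fps_5_mod_2: "fps_of_int_coeffs (sigma_fps 5) = odd_divisors_fps"
proof (rule fps_ext)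
  fix n
  show "fps_nth (fps_of_int_coeffs (sigma_fps 5)) n = fps_nth odd_divisors_fps n"
  proof (cases "n = 0")
    case False
    then show ?thesis
      using of_nat_sum_odd[of "{d. d dvd n}" "\<lambda>d. d ^ 5"]
      by (simp add: sigma_fps_def divisor_sum_def odd_divisors_fps_def)
  qed (simp add: sigma_fps_def divisor_sum_def odd_divisors_fps_def)
qed

text \<open>By the congruence modulo 24, the summand of a divisor \<open>d\<close> is odd exactly
  when \<open>d\<close> is.\<close>

lemma Delta_linear_mod_2: "fps_of_int_coeffs Delta_linear = odd_divisors_fps"
proof (rule fps_ext)
  fix n
  have *: "odd ((5 * d ^ 3 + 7 * d ^ 5) div 12) \<longleftrightarrow> odd d" for d :: nat
  proof -
    have "odd (x div 12) \<longleftrightarrow> odd d" if "x mod 24 = (if odd d then 12 else 0)" for x :: nat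
      using that by (cases "odd d"; simp; presburger)
    then show ?thesis using mod_24_quintic by blast
  qed
  show "fps_nth (fps_of_int_coeffs Delta_linear) n = fps_nth odd_divisors_fps n"
  proof (cases "n = 0")
    case False
    then have "fps_nth (fps_of_int_coeffs Delta_linear :: bit fps) n
        = of_nat (\<Sum>d | d dvd n. (5 * d ^ 3 + 7 * d ^ 5) div 12)"
      by (simp add: Delta_linear_def)
    also have "\<dots> = of_nat (card {d \<in> {d. d dvd n}. odd d})"
      using False * by (intro of_nat_sum_odd) auto
    finally show ?thesis using False by (simp add: odd_divisors_fps_def)
  qed (simp add: Delta_linear_def odd_divisors_fps_def)
qed

text \<open>The involution \<open>d \<mapsto> n div d\<close> on the divisors can fix only a square
  root of \<open>n\<close>.\<close>

lemma of_nat_card_divisors: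
  fixes n :: nat
  assumes "n > 0"
  shows "(of_nat (card {d. d dvd n}) :: bit) = of_bool (\<exists>d. n = d\<^sup>2)"
proof -
  have "(of_nat (card {d. d dvd n}) :: bit) = (\<Sum>d | d dvd n. 1)" by simp
  also have "\<dots> = (\<Sum>d | d \<in> {d. d dvd n} \<and> n div d = d. 1)"
    using assms by (intro sum_involution_bit) (auto elim!: dvdE)
  also have "{d. d \<in> {d. d dvd n} \<and> n div d = d} = {d. True \<and> n = d\<^sup>2}"
    using assms by (auto simp: power2_eq_square elim!: dvdE)
  finally show ?thesis
    by (simp only: sum_constant card_square_roots) simp
qed

text \<open>The square has only even exponents. At odd \<open>n\<close> all divisors are odd, and
  their number is odd exactly for squares. At \<open>n = 2 * m\<close> the odd divisors of
  \<open>n\<close> and \<open>m\<close> agree, so the two contributions cancel.\<close>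

lemma F_eq_odd_divisors: "F = odd_divisors_fps + odd_divisors_fps ^ 2"
proof (rule fps_ext)
  fix n :: nat
  consider "n = 0" | "odd n" | m where "n = 2 * m" "m > 0"
    by (metis evenE gr0I mult_0_right)
  then show "fps_nth F n = fps_nth (odd_divisors_fps + odd_divisors_fps ^ 2) n"
  proof cases
    case 1
    then show ?thesis by (simp add: bit_fps_square V_nth odd_divisors_fps_def)
  next
    case 2
    then have "{d. d dvd n \<and> odd d} = {d. d dvd n}" "n > 0"
      by (auto dest: dvd_trans intro: odd_pos)
    moreover have "(\<exists>d. n = d\<^sup>2) \<longleftrightarrow> (\<exists>d. odd d \<and> n = d\<^sup>2)" using 2 by auto
    ultimately show ?thesis
      using 2 by (simp add: bit_fps_square V_nth odd_divisors_fps_def of_nat_card_divisors F_def)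
  next
    case 3
    have "coprime d 2" if "odd d" for d :: nat using that by simp
    then have "{d. d dvd n \<and> odd d} = {d. d dvd m \<and> odd d}"
      using 3 by (auto simp: coprime_dvd_mult_right_iff)
    moreover have "\<not> (\<exists>d. odd d \<and> n = d\<^sup>2)" using 3 by (metis even_mult_iff even_power dvd_triv_left)
    ultimately show ?thesis
      using 3 by (simp add: bit_fps_square V_nth odd_divisors_fps_def F_def)
  qed
qed

text \<open>The coefficients 100 and 8000 are even and 147 is odd, which leaves the linear part and
  the square of \<open>sigma_fps 5\<close>.\<close>

lemma Delta_fps_mod_2: "fps_of_int_coeffs Delta_fps = F"
  unfolding Delta_fps_def F_eq_odd_divisors
  by (simp only: fps_of_int_coeffs_hom fps_of_int_coeffs_power fps_of_int_coeffs_numeral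
      sigma_fps_5_mod_2 Delta_linear_mod_2) (simp add: diff_conv_add_uminus del: add_uminus_conv_diff)

section \<open>Membership in \<open>M 12\<close>\<close>

lemma exp_eq_nome_power: "exp (2 * pi * \<i> * of_nat n * z) = nome z ^ n"
  unfolding nome_power by (simp add: nome_def mult_ac)

lemma F_in_M: "F \<in> M 12"
  unfolding M_def
proof (intro CollectI exI conjI ballI allI)
  show "modular_form_Gamma0 5 12 Delta" by (rule modular_form_Delta)
  show "(\<lambda>n. of_int (fps_nth Delta_fps n) * exp (2 * pi * \<i> * of_nat n * z)) sums Delta z"
    if "z \<in> upper_half_plane" for z
    unfolding exp_eq_nome_power using that by (intro Delta_sums) (simp add: upper_half_plane_def)
  show "fps_nth F n = of_int (fps_nth Delta_fps n)" for n
    by (simp flip: Delta_fps_mod_2)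
qed

lemma G_in_M: "G \<in> M 12"
  unfolding M_def
proof (intro CollectI exI conjI ballI allI)
  let ?a = "\<lambda>n. if 5 dvd n then fps_nth Delta_fps (n div 5) else 0"
  show "modular_form_Gamma0 5 12 (\<lambda>z. Delta (5 * z))" by (rule modular_form_Delta_5)
  show "(\<lambda>n. of_int (?a n) * exp (2 * pi * \<i> * of_nat n * z)) sums Delta (5 * z)"
    if "z \<in> upper_half_plane" for z
  proof -
    have "(\<lambda>n. of_int (fps_nth Delta_fps n) * nome (5 * z) ^ n) sums Delta (5 * z)"
      using that by (intro Delta_sums) (simp add: upper_half_plane_def)
    also have "(\<lambda>n. of_int (fps_nth Delta_fps n) * nome (5 * z) ^ n)
        = (\<lambda>n. of_int (?a (5 * n)) * nome z ^ (5 * n))"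
      by (simp add: nome_power mult_ac)
    \<comment> \<open>The coefficients \<open>?a n\<close> vanish off the multiples of 5, so
      inserting these terms does not change the sum.\<close>
    also have "\<dots> sums Delta (5 * z) \<longleftrightarrow> (\<lambda>n. of_int (?a n) * nome z ^ n) sums Delta (5 * z)"
      by (rule sums_mono_reindex) (auto simp: strict_mono_def elim!: dvdE)
    finally show ?thesis unfolding exp_eq_nome_power .
  qed
  show "fps_nth G n = of_int (?a n)" for n
    by (simp add: G_def flip: Delta_fps_mod_2)
qed

theorem theorem1p12:
  shows "F \<in> M 12 \<and> G \<in> M 12 \<and>
         G = r ^ 5 * (r + 1) \<and> F = r * (r + 1) ^ 5 \<and> (F + G) ^ 6 = F * G"
  using F_in_M G_in_M G_eq_r F_eq_r level5_relation by blast

end
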